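(* Let $m\ge 2$ and let the numerical semigroup $S=S(\mathbf d^m)$, minimally generated by $\mathbf d^m=\{d_1,\dots,d_m\}$, be almost symmetric. Then its Hilbert series $H(\mathbf d^m;z)=\sum_{s\in S}z^s$, regarded as a rational function of $z$, satisfies the duality relation $$H(\mathbf d^m;z)+H(\mathbf d^m;z^{-1})\cdot z^{F}+Q'_{m-1}(\mathbf d^m;z)\cdot z^{-\Sigma_m}=0,$$ where $F=F(\mathbf d^m)$ is the Frobenius number, $\Sigma_m=\sum_{k=1}^m d_k$, and $Q'_{m-1}$ is defined in the context.
   Context: Let $d_1<\dots<d_m$ be positive integers with $\gcd(d_1,\dots,d_m)=1$, none of which is a nonnegative integer linear combination of the others, and let $S=S(\mathbf d^m)=\{\sum_{i=1}^m x_id_i : x_i\in\mathbb Z_{\ge 0}\}$. The Frobenius number $F$ is the largest integer not in $S$. Put $S'=\{x\in\mathbb Z : x\notin S,\ x+s\in S \text{ for all } s\in S\setminus\{0\}\}$ and $\Delta_{\mathcal H}=\{h\notin S : F-h\notin S\}$. The semigroup $S$ is called almost symmetric if $S'\setminus\{F\}=\Delta_{\mathcal H}$. Syzygies. Let $k$ be a field of characteristic $0$, and regard $k[z^{d_1},\dots,z^{d_m}]$ as a graded module over $k[X_1,\dots,X_m]$, $\deg X_i=d_i$, via $X_i\mapsto z^{d_i}$. The Hilbert series is written $H(\mathbf d^m;z)=Q(\mathbf d^m;z)/\prod_{j=1}^m(1-z^{d_j})$ with $Q=1-Q_1+Q_2-\dots+(-1)^{m-1}Q_{m-1}$ and $Q_i(\mathbf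 d^m;z)=\sum_{j=1}^{\beta_i}z^{C_{j,i}}$ for $1\le i\le m-1$. The summands $z^{C_{j,i}}$ stand for the syzygies of the $i$th kind (those of the $i$th step of the minimal graded free resolution); the positive integers $C_{j,i}$ are called the syzygy degrees and the numbers $\beta_i$ of terms the Betti numbers. They are subject to the standing requirements $C_{j+1,i}\ge C_{j,i}$, $C_{\beta_{i+1},i+1}>C_{\beta_i,i}$, $C_{1,i+1}>C_{1,i}$, and $$C_{j,i}\ne C_{r,i+2k-1}\quad\text{for } 1\le j\le\beta_i,\ 1\le r\le\beta_{i+2k-1},\ 1\le k\le\lfloor (m-i)/2\rfloor ;$$ the last requirement means that all necessary cancellations of terms $z^{C_{j,i}}$ in the alternating sum $Q$ are already performed. The polynomial $Q'_{m-1}$ is defined by $Q_{m-1}(\mathbf d^m;z)=Q'_{m-1}(\mathbf d^m;z)+z^{F+\Sigma_m}$, where $\deg Q'_{m-1}<F+\Sigma_m$. *)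

theory Defs
  imports
    "HOL-Library.Poly_Mapping"
    "HOL-Computational_Algebra.Computational_Algebra"
    "HOL-Computational_Algebra.Field_as_Ring"
begin

section \<open>Numerical semigroups\<close>

text \<open>Generators are indexed as \<open>d 1, \<dots>, d m\<close>; all sets of numbers live in the integers.\<close>

definition num_semigroup :: "nat \<Rightarrow> (nat \<Rightarrow> nat) \<Rightarrow> int set" where
  "num_semigroup m d = {int (\<Sum>i=1..m. x i * d i) | x :: nat \<Rightarrow> nat. True}"

definition minimal_generators :: "nat \<Rightarrow> (nat \<Rightarrow> nat) \<Rightarrow> bool" where
  "minimal_generators m d \<longleftrightarrow>
     (\<forall>i\<in>{1..m}. 0 < d i) \<and>
     strict_mono_on {1..m} d \<and>
     Gcd (d ` {1..m}) = 1 \<and>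
     (\<forall>i\<in>{1..m}. \<nexists>x :: nat \<Rightarrow> nat. d i = (\<Sum>j\<in>{1..m} - {i}. x j * d j))"

definition frobenius :: "int set \<Rightarrow> int" where
  "frobenius S = (GREATEST x. x \<notin> S)"

definition pseudo_frobenius :: "int set \<Rightarrow> int set" where
  "pseudo_frobenius S = {x. x \<notin> S \<and> (\<forall>s\<in>S - {0}. x + s \<in> S)}"

definition delta_H :: "int set \<Rightarrow> int set" where
  "delta_H S = {h. h \<notin> S \<and> frobenius S - h \<notin> S}"

definition almost_symmetric :: "int set \<Rightarrow> bool" where
  "almost_symmetric S \<longleftrightarrow> pseudo_frobenius S - {frobenius S} = delta_H S"


section \<open>Minimal graded free resolutions of semigroup rings\<close>

text \<open>
  A polynomial in variables \<open>X\<^sub>i\<close>, \<open>i :: nat\<close>, is a finitely supported map from exponent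
  vectors to coefficients; \<open>poly_ring m\<close> is its subring in \<open>X\<^sub>1, \<dots>, X\<^sub>m\<close>. An element of a
  free module of rank \<open>b\<close> over it is a map from \<open>nat\<close> that vanishes outside \<open>{1..b}\<close>.
\<close>

type_synonym 'k mpoly = "(nat \<Rightarrow>\<^sub>0 nat) \<Rightarrow>\<^sub>0 'k"

definition poly_ring :: "nat \<Rightarrow> 'k::field mpoly set" where
  "poly_ring m = {p. \<forall>a\<in>Poly_Mapping.keys p. Poly_Mapping.keys a \<subseteq> {1..m}}"

definition irrelevant_ideal :: "nat \<Rightarrow> 'k::field mpoly set" where
  "irrelevant_ideal m = {p \<in> poly_ring m. Poly_Mapping.lookup p 0 = 0}"

text \<open>Degree of the monomial \<open>X\<^sup>a\<close> for the grading \<open>deg X\<^sub>i = d i\<close>.\<close>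

definition monom_deg :: "(nat \<Rightarrow> nat) \<Rightarrow> (nat \<Rightarrow>\<^sub>0 nat) \<Rightarrow> nat" where
  "monom_deg d a = (\<Sum>i\<in>Poly_Mapping.keys a. Poly_Mapping.lookup a i * d i)"

text \<open>
  The ring homomorphism \<open>X\<^sub>i \<mapsto> z ^ d i\<close>, which makes its image \<open>k[z^d\<^sub>1, \<dots>, z^d\<^sub>m]\<close> a
  graded module.
\<close>

definition semigroup_ring_map :: "(nat \<Rightarrow> nat) \<Rightarrow> 'k::field mpoly \<Rightarrow> 'k poly" where
  "semigroup_ring_map d p =
     (\<Sum>a\<in>Poly_Mapping.keys p. monom (Poly_Mapping.lookup p a) (monom_deg d a))"

text \<open>Vectors of length \<open>b\<close> with entries in \<open>A\<close>.\<close>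

definition free_vectors :: "'k::field mpoly set \<Rightarrow> nat \<Rightarrow> (nat \<Rightarrow> 'k mpoly) set" where
  "free_vectors A b = {v. (\<forall>j\<in>{1..b}. v j \<in> A) \<and> (\<forall>j. j \<notin> {1..b} \<longrightarrow> v j = 0)}"

text \<open>
  The degree \<open>n\<close> part of the graded free module \<open>R(-c 1) \<oplus> \<dots> \<oplus> R(-c b)\<close>,
  whose \<open>j\<close>th basis vector has degree \<open>c j\<close>.
\<close>

definition graded_part ::
    "nat \<Rightarrow> (nat \<Rightarrow> nat) \<Rightarrow> nat \<Rightarrow> (nat \<Rightarrow> nat) \<Rightarrow> nat \<Rightarrow> (nat \<Rightarrow> 'k::field mpoly) set" where
  "graded_part m d b c n =
     {v \<in> free_vectors (poly_ring m) b.
        \<forall>j\<in>{1..b}. \<forall>a\<in>Poly_Mapping.keys (v j). monom_deg d a + c j = n}"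

text \<open>
  \<open>\<dots> \<rightarrow> F\<^sub>2 \<rightarrow> F\<^sub>1 \<rightarrow> F\<^sub>0 = R \<rightarrow> k[z^d\<^sub>1, \<dots>, z^d\<^sub>m] \<rightarrow> 0\<close> is a minimal graded free resolution,
  where \<open>F\<^sub>i\<close> has rank \<open>\<beta> i\<close> and basis degrees \<open>C 1 i, \<dots>, C (\<beta> i) i\<close>, and \<open>D i\<close> maps
  \<open>F\<^sub>i\<close> to \<open>F\<^sub>i\<^sub>-\<^sub>1\<close> for \<open>i \<ge> 1\<close>. The conditions on \<open>D\<close> are: linearity, degree 0, exactness
  (at \<open>F\<^sub>0\<close> and at \<open>F\<^sub>i\<close>, \<open>i \<ge> 1\<close>), and minimality (the image of \<open>D\<close> lies in \<open>(X\<^sub>1, \<dots>, X\<^sub>m) F\<^sub>i\<close>).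
  The module is cyclic, so \<open>F\<^sub>0 = R\<close>; no bound on the length is imposed, as zero modules
  \<open>F\<^sub>i\<close> are allowed.
\<close>

definition minimal_graded_resolution ::
    "nat \<Rightarrow> (nat \<Rightarrow> nat) \<Rightarrow> (nat \<Rightarrow> nat) \<Rightarrow> (nat \<Rightarrow> nat \<Rightarrow> nat) \<Rightarrow>
     (nat \<Rightarrow> (nat \<Rightarrow> 'k::field mpoly) \<Rightarrow> (nat \<Rightarrow> 'k mpoly)) \<Rightarrow> bool" where
  "minimal_graded_resolution m d \<beta> C D \<longleftrightarrow>
     (let F = (\<lambda>i. free_vectors (poly_ring m) (\<beta> i)) in
      \<beta> 0 = 1 \<and> C 1 0 = 0 \<and>
      (\<forall>i. \<forall>u\<in>F (Suc i). \<forall>v\<in>F (Suc i).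
         D (Suc i) (\<lambda>j. u j + v j) = (\<lambda>j. D (Suc i) u j + D (Suc i) v j)) \<and>
      (\<forall>i. \<forall>p\<in>poly_ring m. \<forall>v\<in>F (Suc i).
         D (Suc i) (\<lambda>j. p * v j) = (\<lambda>j. p * D (Suc i) v j)) \<and>
      (\<forall>i n. D (Suc i) ` graded_part m d (\<beta> (Suc i)) (\<lambda>j. C j (Suc i)) n
               \<subseteq> graded_part m d (\<beta> i) (\<lambda>j. C j i) n) \<and>
      D 1 ` F 1 = {v \<in> F 0. semigroup_ring_map d (v 1) = 0} \<and>
      (\<forall>i. D (Suc (Suc i)) ` F (Suc (Suc i)) = {v \<in> F (Suc i). D (Suc i) v = (\<lambda>_. 0)}) \<and>
      (\<forall>i. D (Suc i) ` F (Suc i) \<subseteq> free_vectors (irrelevant_ideal m) (\<beta> i)))"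

text \<open>
  Standing requirements on the syzygy degrees. The last one says that no term cancels in
  the alternating sum \<open>1 - Q\<^sub>1 + Q\<^sub>2 - \<dots>\<close>.
\<close>

definition syzygy_degree_requirements ::
    "nat \<Rightarrow> (nat \<Rightarrow> nat) \<Rightarrow> (nat \<Rightarrow> nat \<Rightarrow> nat) \<Rightarrow> bool" where
  "syzygy_degree_requirements m \<beta> C \<longleftrightarrow>
     (\<forall>i\<in>{1..m-1}. \<forall>j\<in>{1..\<beta> i}. 0 < C j i) \<and>
     (\<forall>i\<in>{1..m-1}. \<forall>j\<in>{1..<\<beta> i}. C j i \<le> C (j + 1) i) \<and>
     (\<forall>i\<in>{1..<m-1}. C (\<beta> i) i < C (\<beta> (i + 1)) (i + 1)) \<and>
     (\<forall>i\<in>{1..<m-1}. C 1 i < C 1 (i + 1)) \<and>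
     (\<forall>i\<in>{1..m-1}. \<forall>k\<in>{1..(m - i) div 2}. \<forall>j\<in>{1..\<beta> i}. \<forall>r\<in>{1..\<beta> (i + 2 * k - 1)}.
        C j i \<noteq> C r (i + 2 * k - 1))"

definition syzygy_poly :: "(nat \<Rightarrow> nat) \<Rightarrow> (nat \<Rightarrow> nat \<Rightarrow> nat) \<Rightarrow> nat \<Rightarrow> rat poly" where
  "syzygy_poly \<beta> C i = (\<Sum>j=1..\<beta> i. monom 1 (C j i))"


section \<open>Hilbert series as rational functions\<close>

type_synonym ratfun = "rat poly fract"

definition ratfun_z :: ratfun where
  "ratfun_z = to_fract [:0, 1:]"

text \<open>
  Substitution of \<open>y\<close> for \<open>z\<close> in \<open>f\<close>; here \<open>quot_of_fract\<close> gives numerator and denominator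
  in lowest terms. It is meaningful if the denominator does not vanish at \<open>y\<close>, as is the
  case for \<open>y = inverse ratfun_z\<close>.
\<close>

definition ratfun_subst :: "ratfun \<Rightarrow> ratfun \<Rightarrow> ratfun" where
  "ratfun_subst f y =
     (let ev = (\<lambda>p. poly (map_poly (\<lambda>c. to_fract [:c:]) p) y)
      in ev (fst (quot_of_fract f)) / ev (snd (quot_of_fract f)))"

definition hilbert_fps :: "int set \<Rightarrow> rat fps" where
  "hilbert_fps S = Abs_fps (\<lambda>n. if int n \<in> S then 1 else 0)"

text \<open>The unique rational function whose power series expansion at 0 is the given series.\<close>

definition hilbert_series :: "int set \<Rightarrow> ratfun" where
  "hilbert_series S =
     (THE h. \<exists>a b. b \<noteq> 0 \<and> h = Fraction_Field.Fract a b \<and>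
        fps_of_poly b * hilbert_fps S = fps_of_poly a)"

end

theory Submission
  imports Defs "HOL-Library.Function_Algebras"
begin

text \<open>
  Let \<open>P\<close> be the minimal resolution of \<open>k[S]\<close>. Since \<open>X\<^sub>1\<close> is regular on \<open>k[S]\<close>, the complex
  \<open>P / (X\<^sub>1, \<dots>, X\<^sub>r) P\<close> has \<open>H\<^sub>i = 0\<close> for \<open>i \<ge> max 1 r\<close>, so that the connecting map identifies
  \<open>H\<^sub>r\<close> of \<open>P / (X\<^sub>1, \<dots>, X\<^sub>r\<^sub>+\<^sub>1) P\<close> with the kernel of \<open>X\<^sub>r\<^sub>+\<^sub>1\<close> on \<open>H\<^sub>r\<^sub>-\<^sub>1\<close> of
  \<open>P / (X\<^sub>1, \<dots>, X\<^sub>r) P\<close>. Iterating from \<open>r = 1\<close> to \<open>m - 1\<close> identifies the top syzygies with the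
  socle of \<open>k[S] / z ^ d\<^sub>1 k[S]\<close>, so that \<open>Q\<^sub>m\<^sub>-\<^sub>1\<close> is the sum of the \<open>z ^ (f + \<Sigma>\<^sub>m)\<close> over the
  pseudo-Frobenius numbers \<open>f\<close>. For almost symmetric \<open>S\<close> this gives
  \<open>Q'\<^sub>m\<^sub>-\<^sub>1 = (\<Sum>h\<in>\<Delta>\<^sub>H. z ^ (h + \<Sigma>\<^sub>m))\<close>, and
  \<open>H(z) + H(z\<^sup>-\<^sup>1) z ^ F + (\<Sum>h\<in>\<Delta>\<^sub>H. z ^ h) = 0\<close> holds for every numerical semigroup.
\<close>

section \<open>Complexes with a partially regular sequence of operators\<close>

text \<open>
  \<open>E i n\<close> is the degree \<open>n\<close> part of \<open>F\<^sub>i\<close>, \<open>X j\<close> multiplies by the \<open>j\<close>th variable and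
  \<open>I r i n\<close> is the degree \<open>n\<close> part of \<open>(X\<^sub>1, \<dots>, X\<^sub>r) F\<^sub>i\<close>.
\<close>

locale regular_complex =
  fixes E :: "nat \<Rightarrow> int \<Rightarrow> 'a::ab_group_add set"
    and D :: "nat \<Rightarrow> 'a \<Rightarrow> 'a"
    and X :: "nat \<Rightarrow> 'a \<Rightarrow> 'a"
    and deg :: "nat \<Rightarrow> int"
    and I :: "nat \<Rightarrow> nat \<Rightarrow> int \<Rightarrow> 'a set"
    and m :: nat
  assumes E_zero: "0 \<in> E i n"
    and E_diff: "u \<in> E i n \<Longrightarrow> v \<in> E i n \<Longrightarrow> u - v \<in> E i n"
    and X_diff: "X j (u - v) = X j u - X j v"
    and X_commute: "X j (X k u) = X k (X j u)"
    and X_in_E: "j \<in> {1..m} \<Longrightarrow> u \<in> E i n \<Longrightarrow> X j u \<in> E i (n + deg j)"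
    and D_in_E: "u \<in> E (Suc i) n \<Longrightarrow> D (Suc i) u \<in> E i n"
    and D_diff: "u \<in> E (Suc i) n \<Longrightarrow> v \<in> E (Suc i) n \<Longrightarrow>
      D (Suc i) (u - v) = D (Suc i) u - D (Suc i) v"
    and D_X: "j \<in> {1..m} \<Longrightarrow> u \<in> E (Suc i) n \<Longrightarrow> D (Suc i) (X j u) = X j (D (Suc i) u)"
    and D_D: "u \<in> E (Suc (Suc i)) n \<Longrightarrow> D (Suc i) (D (Suc (Suc i)) u) = 0"
    and D_exact: "u \<in> E (Suc i) n \<Longrightarrow> D (Suc i) u = 0 \<Longrightarrow>
      \<exists>v\<in>E (Suc (Suc i)) n. D (Suc (Suc i)) v = u"
    and I_0: "I 0 i n = {0}"
    and I_Suc: "r < m \<Longrightarrow>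
      I (Suc r) i n = {X (Suc r) w + u | w u. w \<in> E i (n - deg (Suc r)) \<and> u \<in> I r i n}"
    and I_regular: "r < m \<Longrightarrow> w \<in> E i n \<Longrightarrow> X (Suc r) w \<in> I r i (n + deg (Suc r)) \<Longrightarrow>
      w \<in> I r i n"
    and H0_regular: "w \<in> E 0 n \<Longrightarrow> X 1 w \<in> D 1 ` E 1 (n + deg 1) \<Longrightarrow> w \<in> D 1 ` E 1 n"
begin

section \<open>Additivity of the operators and stability of the submodules
  \<open>I r i n\<close>\<close>

lemma E_uminus: "u \<in> E i n \<Longrightarrow> - u \<in> E i n"
  using E_diff[OF E_zero, of u i n] by simp

lemma E_add: "u \<in> E i n \<Longrightarrow> v \<in> E i n \<Longrightarrow> u + v \<in> E i n"
  using E_diff[OF _ E_uminus, of u i n v] by simp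

lemma X_zero: "X j 0 = 0"
  using X_diff[of j 0 0] by simp

lemma X_uminus: "X j (- u) = - X j u"
  using X_diff[of j 0 u] by (simp add: X_zero)

lemma X_add: "X j (u + v) = X j u + X j v"
  using X_diff[of j u "- v"] by (simp add: X_uminus)

lemma D_zero: "D (Suc i) 0 = 0"
  using D_diff[OF E_zero E_zero, of i] by simp

lemma D_uminus: "u \<in> E (Suc i) n \<Longrightarrow> D (Suc i) (- u) = - D (Suc i) u"
  using D_diff[OF E_zero, of u i n] by (simp add: D_zero)

lemma D_add: "u \<in> E (Suc i) n \<Longrightarrow> v \<in> E (Suc i) n \<Longrightarrow>
    D (Suc i) (u + v) = D (Suc i) u + D (Suc i) v"
  using D_diff[OF _ E_uminus, of u i n v] by (simp add: D_uminus)

lemma X_in_E': "j \<in> {1..m} \<Longrightarrow> u \<in> E i (n - deg j) \<Longrightarrow> X j u \<in> E i n"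
  using X_in_E[of j u i "n - deg j"] by simp

lemma I_SucI: "r < m \<Longrightarrow> w \<in> E i (n - deg (Suc r)) \<Longrightarrow> u \<in> I r i n \<Longrightarrow>
    X (Suc r) w + u \<in> I (Suc r) i n"
  by (auto simp: I_Suc)

lemma I_in_E: "r \<le> m \<Longrightarrow> u \<in> I r i n \<Longrightarrow> u \<in> E i n"
proof (induction r arbitrary: u)
  case (Suc r)
  then obtain w v where "u = X (Suc r) w + v" "w \<in> E i (n - deg (Suc r))" "v \<in> I r i n"
    by (auto simp: I_Suc)
  with Suc show ?case by (auto intro!: E_add X_in_E')
qed (auto simp: I_0 E_zero)

lemma I_zero: "r \<le> m \<Longrightarrow> 0 \<in> I r i n"
proof (induction r)
  case (Suc r)
  then have "X (Suc r) 0 + 0 \<in> I (Suc r) i n"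
    using I_SucI[OF _ E_zero, of r 0 i n] by simp
  then show ?case by (simp add: X_zero)
qed (simp add: I_0)

lemma I_diff: "r \<le> m \<Longrightarrow> u \<in> I r i n \<Longrightarrow> v \<in> I r i n \<Longrightarrow> u - v \<in> I r i n"
proof (induction r arbitrary: u v)
  case (Suc r)
  then obtain w u' w' v' where *: "u = X (Suc r) w + u'" "w \<in> E i (n - deg (Suc r))" "u' \<in> I r i n"
    "v = X (Suc r) w' + v'" "w' \<in> E i (n - deg (Suc r))" "v' \<in> I r i n"
    by (auto simp: I_Suc)
  then have "u - v = X (Suc r) (w - w') + (u' - v')" by (simp add: X_diff)
  moreover have "u' - v' \<in> I r i n" using Suc * by auto
  moreover have "w - w' \<in> E i (n - deg (Suc r))" using * E_diff by auto
  ultimately show ?case using Suc.prems by (auto simp: I_Suc)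
qed (simp add: I_0)

lemma I_uminus: "r \<le> m \<Longrightarrow> u \<in> I r i n \<Longrightarrow> - u \<in> I r i n"
  using I_diff[OF _ I_zero, of r u i n] by simp

lemma I_add: "r \<le> m \<Longrightarrow> u \<in> I r i n \<Longrightarrow> v \<in> I r i n \<Longrightarrow> u + v \<in> I r i n"
  using I_diff[OF _ _ I_uminus, of r u i n v] by simp

lemma X_in_I: "r < m \<Longrightarrow> w \<in> E i (n - deg (Suc r)) \<Longrightarrow> X (Suc r) w \<in> I (Suc r) i n"
  using I_SucI[OF _ _ I_zero, of r w i n] by simp

lemma I_D: "r \<le> m \<Longrightarrow> u \<in> I r (Suc i) n \<Longrightarrow> D (Suc i) u \<in> I r i n"
proof (induction r arbitrary: u)
  case (Suc r)
  then obtain w u' where *: "u = X (Suc r) w + u'" "w \<in> E (Suc i) (n - deg (Suc r))"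
    "u' \<in> I r (Suc i) n"
    by (auto simp: I_Suc)
  have "X (Suc r) w \<in> E (Suc i) n" "u' \<in> E (Suc i) n"
    using * Suc.prems by (auto intro: X_in_E' I_in_E[of r])
  then have "D (Suc i) u = X (Suc r) (D (Suc i) w) + D (Suc i) u'"
    using * Suc.prems by (simp add: D_add D_X)
  moreover have "D (Suc i) u' \<in> I r i n" using Suc * by auto
  moreover have "D (Suc i) w \<in> E i (n - deg (Suc r))" using * D_in_E by auto
  ultimately show ?case using Suc.prems by (auto simp: I_Suc)
qed (simp add: I_0 D_zero)

text \<open>Multiplication by a ring element of degree \<open>t\<close> on the whole complex.\<close>

definition chain_op :: "int \<Rightarrow> ('a \<Rightarrow> 'a) \<Rightarrow> bool" where
  "chain_op t T \<longleftrightarrow> (\<forall>u v. T (u - v) = T u - T v) \<and>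
     (\<forall>i n u. u \<in> E i n \<longrightarrow> T u \<in> E i (n + t)) \<and>
     (\<forall>i n u. u \<in> E (Suc i) n \<longrightarrow> D (Suc i) (T u) = T (D (Suc i) u)) \<and>
     (\<forall>j u. T (X j u) = X j (T u))"

lemma chain_op_X: "j \<in> {1..m} \<Longrightarrow> chain_op (deg j) (X j)"
  using X_diff X_in_E D_X X_commute unfolding chain_op_def by metis

lemma chain_op_zero: "chain_op t T \<Longrightarrow> T 0 = 0"
  unfolding chain_op_def by (metis diff_self)

lemma chain_op_add: "chain_op t T \<Longrightarrow> T (u + v) = T u + T v"
proof -
  assume T: "chain_op t T"
  then have *: "T (u - v) = T u - T v" for u v unfolding chain_op_def by blast
  have "T u = T ((u + v) - v)" by simp
  also have "\<dots> = T (u + v) - T v" by (rule *)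
  finally show ?thesis by (simp add: algebra_simps)
qed

lemma chain_op_I: "chain_op t T \<Longrightarrow> r \<le> m \<Longrightarrow> u \<in> I r i n \<Longrightarrow> T u \<in> I r i (n + t)"
proof (induction r arbitrary: u)
  case 0
  then show ?case by (simp add: I_0 chain_op_zero)
next
  case (Suc r)
  then obtain w u' where *: "u = X (Suc r) w + u'" "w \<in> E i (n - deg (Suc r))" "u' \<in> I r i n"
    by (auto simp: I_Suc)
  have "T u = X (Suc r) (T w) + T u'"
    using chain_op_add[OF Suc.prems(1)] Suc.prems(1) *(1) unfolding chain_op_def by metis
  moreover have "T u' \<in> I r i (n + t)" using Suc * by auto
  moreover have "T w \<in> E i (n + t - deg (Suc r))"
    using * Suc.prems(1) unfolding chain_op_def by (metis add_diff_eq add.commute diff_add_eq)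
  ultimately show ?case using Suc.prems by (auto simp: I_Suc)
qed

text \<open>The induction is the long exact sequence of multiplication by X_{r+1}, written out with
  representatives. For i > 0 the neighbouring groups H_{i+1} and H_i modulo X_1, ..., X_r vanish by
  induction; for i = 0 injectivity of X_1 on H_0 replaces the vanishing of H_0.\<close>

lemma homology_vanishes:
  assumes "r \<le> Suc i" "r \<le> m" "z \<in> E (Suc i) n" "D (Suc i) z \<in> I r i n"
  shows "\<exists>y\<in>E (Suc (Suc i)) n. z - D (Suc (Suc i)) y \<in> I r (Suc i) n"
  using assms
proof (induction r arbitrary: i z n)
  case 0
  then obtain v where "v \<in> E (Suc (Suc i)) n" "D (Suc (Suc i)) v = z"
    using D_exact[of z i n] by (auto simp: I_0)
  then show ?case by (auto simp: I_0)
next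
  case (Suc r)
  let ?X = "X (Suc r)" and ?n' = "n - deg (Suc r)"
  have rm: "r < m" "Suc r \<in> {1..m}" using Suc.prems by auto
  obtain w u where w: "w \<in> E i ?n'" and u: "u \<in> I r i n" and Dz: "D (Suc i) z = ?X w + u"
    using Suc.prems rm by (auto simp: I_Suc)
  have uE: "u \<in> E i n" using I_in_E[OF _ u] rm by simp
  have XwE: "?X w \<in> E i n" using w rm X_in_E' by auto
  have "\<exists>y\<in>E (Suc i) ?n'. w - D (Suc i) y \<in> I r i ?n'"
  proof (cases i)
    case 0
    \<comment> \<open>For i = 0 the bound forces r = 0, hence u = 0, and X_1 can be cancelled on
      H_0.\<close>
    then have "r = 0" using Suc.prems by simp
    then have "?X w \<in> D 1 ` E 1 n" using Dz u Suc.prems 0 by (force simp: I_0)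
    then have "w \<in> D 1 ` E 1 ?n'"
      using H0_regular[of w ?n'] w 0 \<open>r = 0\<close> by simp
    then show ?thesis using 0 \<open>r = 0\<close> by (auto simp: I_0)
  next
    case (Suc i')
    have "D i (D (Suc i) z) = 0" using D_D Suc Suc.prems by blast
    \<comment> \<open>Applying D to Dz = X w + u gives X (D w) = - D u; cancelling the regular X
      makes w a cycle modulo X_1, ..., X_r.\<close>
    then have "?X (D i w) = - D i u"
      using Dz D_add[of "?X w" i' n u] D_X[of "Suc r" w i'] w uE XwE Suc rm
      by (simp add: eq_neg_iff_add_eq_0)
    moreover have "D i u \<in> I r i' n" using I_D u Suc rm by simp
    ultimately have "?X (D i w) \<in> I r i' (?n' + deg (Suc r))" using I_uminus rm by simp
    then have "D i w \<in> I r i' ?n'"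
      using I_regular[of r "D i w" i' ?n'] D_in_E[of w i'] w Suc rm by simp
    then show ?thesis using Suc.IH[of i' w ?n'] Suc.prems Suc w rm by simp
  qed
  then obtain y where y: "y \<in> E (Suc i) ?n'" "w - D (Suc i) y \<in> I r i ?n'" by blast
  have XyE: "?X y \<in> E (Suc i) n" using y rm X_in_E' by auto
  \<comment> \<open>Subtracting X y leaves z unchanged modulo X_1, ..., X_{r+1} but moves its
    boundary into \<open>I r i n\<close>, so the induction hypothesis applies again, now at i
    itself.\<close>
  have "D (Suc i) (z - ?X y) = ?X (w - D (Suc i) y) + u"
    using Suc.prems XyE y Dz rm by (simp add: D_diff D_X X_diff)
  moreover have "?X (w - D (Suc i) y) \<in> I r i n"
    using chain_op_I[OF chain_op_X[OF rm(2)] _ y(2)] rm by simp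
  ultimately have "D (Suc i) (z - ?X y) \<in> I r i n"
    using I_add u rm by simp
  then obtain x where x: "x \<in> E (Suc (Suc i)) n" "z - ?X y - D (Suc (Suc i)) x \<in> I r (Suc i) n"
    using Suc.IH[of i "z - ?X y" n] Suc.prems rm E_diff XyE by auto
  have "z - D (Suc (Suc i)) x = ?X y + (z - ?X y - D (Suc (Suc i)) x)" by simp
  then have "z - D (Suc (Suc i)) x \<in> I (Suc r) (Suc i) n"
    unfolding I_Suc[OF rm(1)] using x(2) y(1) by blast
  then show ?case using x(1) by blast
qed

text \<open>
  \<open>Z q n / B q n\<close> is the degree \<open>n\<close> part of \<open>H\<^sub>q\<close> of the complex modulo \<open>X\<^sub>1, \<dots>, X\<^sub>q\<^sub>+\<^sub>1\<close>.
\<close>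

definition Z :: "nat \<Rightarrow> int \<Rightarrow> 'a set" where
  "Z q n = {z \<in> E q n. \<forall>i. q = Suc i \<longrightarrow> D q z \<in> I (Suc q) i n}"

definition B :: "nat \<Rightarrow> int \<Rightarrow> 'a set" where
  "B q n = {D (Suc q) y + u | y u. y \<in> E (Suc q) n \<and> u \<in> I (Suc q) q n}"

text \<open>
  The composition of the connecting maps \<open>H\<^sub>i\<^sub>+\<^sub>1 \<rightarrow> H\<^sub>i\<close> for \<open>i = q - 1, \<dots>, 0\<close>, each belonging to
  the variable \<open>X\<^sub>i\<^sub>+\<^sub>2\<close>, as a relation between representatives.
\<close>

fun connecting :: "nat \<Rightarrow> int \<Rightarrow> 'a \<Rightarrow> 'a \<Rightarrow> bool" where
  "connecting 0 n z w \<longleftrightarrow> z \<in> E 0 n \<and> z = w"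
| "connecting (Suc q) n z w \<longleftrightarrow> z \<in> E (Suc q) n \<and>
     (\<exists>w'. w' \<in> E q (n - deg (q + 2)) \<and> D (Suc q) z - X (q + 2) w' \<in> I (Suc q) q n \<and>
       connecting q (n - deg (q + 2)) w' w)"

text \<open>The degree lost along \<open>connecting q\<close>. The variable X_1 does not contribute:
  its multiples are already contained in \<open>B 0\<close>.\<close>

definition total_deg :: "nat \<Rightarrow> int" where
  "total_deg q = (\<Sum>j=2..q+1. deg j)"

lemma total_deg_0: "total_deg 0 = 0"
  and total_deg_Suc: "total_deg (Suc q) = total_deg q + deg (q + 2)"
  by (simp_all add: total_deg_def)

lemma connecting_in_E: "connecting q n z w \<Longrightarrow> w \<in> E 0 (n - total_deg q)"
proof (induction q arbitrary: n z)
  case (Suc q)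
  then obtain w' where "connecting q (n - deg (q + 2)) w' w" by auto
  from Suc.IH[OF this] show ?case by (simp add: total_deg_Suc algebra_simps)
qed (simp add: total_deg_0)

lemma connecting_in_Z:
  assumes "q < m" "connecting q n z w"
  shows "z \<in> Z q n"
proof (cases q)
  case (Suc q')
  then obtain w' where w': "z \<in> E q n" "w' \<in> E q' (n - deg (Suc q))"
    "D q z - X (Suc q) w' \<in> I q q' n"
    using assms by auto
  then have "D q z \<in> I (Suc q) q' n"
    using I_SucI[OF assms(1) w'(2,3)] by simp
  with w' Suc show ?thesis by (simp add: Z_def)
qed (use assms in \<open>auto simp: Z_def\<close>)

text \<open>Together with \<open>connecting_well_defined\<close> this makes the image w unique
  modulo \<open>B 0\<close>.\<close>

lemma connecting_diff:
  "q < m \<Longrightarrow> connecting q n z w \<Longrightarrow> connecting q n z' w' \<Longrightarrow> connecting q n (z - z') (w - w')"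
proof (induction q arbitrary: n z z')
  case (Suc q)
  let ?X = "X (q + 2)" and ?n' = "n - deg (q + 2)"
  obtain y y' where y: "z \<in> E (Suc q) n" "y \<in> E q ?n'"
      "D (Suc q) z - ?X y \<in> I (Suc q) q n" "connecting q ?n' y w"
    and y': "z' \<in> E (Suc q) n" "y' \<in> E q ?n'"
      "D (Suc q) z' - ?X y' \<in> I (Suc q) q n" "connecting q ?n' y' w'"
    using Suc.prems by auto
  have "D (Suc q) (z - z') - ?X (y - y') =
      (D (Suc q) z - ?X y) - (D (Suc q) z' - ?X y')"
    using y y' by (simp add: D_diff X_diff)
  then have "D (Suc q) (z - z') - ?X (y - y') \<in> I (Suc q) q n"
    using I_diff[OF _ y(3) y'(3)] Suc.prems(1) by simp
  moreover have "connecting q ?n' (y - y') (w - w')" using Suc.IH y y' Suc.prems(1) by simp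
  ultimately show ?case using E_diff[OF y(1) y'(1)] E_diff[OF y(2) y'(2)] by auto
qed (auto intro: E_diff)

text \<open>Linearity of the connecting maps over the polynomial ring; T will be a variable or a
  scalar.\<close>

lemma connecting_chain_op:
  "chain_op t T \<Longrightarrow> q < m \<Longrightarrow> connecting q n z w \<Longrightarrow> connecting q (n + t) (T z) (T w)"
proof (induction q arbitrary: n z)
  case (Suc q)
  let ?X = "X (q + 2)" and ?n' = "n - deg (q + 2)"
  obtain y where y: "z \<in> E (Suc q) n" "y \<in> E q ?n'"
      "D (Suc q) z - ?X y \<in> I (Suc q) q n" "connecting q ?n' y w"
    using Suc.prems by auto
  have T: "T (u - v) = T u - T v" "u \<in> E i k \<Longrightarrow> T u \<in> E i (k + t)"
    "T (X j u) = X j (T u)" "u \<in> E (Suc i) k \<Longrightarrow> D (Suc i) (T u) = T (D (Suc i) u)"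
    for u v i j k
    using Suc.prems(1) unfolding chain_op_def by blast+
  have n: "?n' + t = n + t - deg (q + 2)" by simp
  have "T (D (Suc q) z - ?X y) \<in> I (Suc q) q (n + t)"
    using chain_op_I[OF Suc.prems(1) _ y(3)] Suc.prems by simp
  then have "D (Suc q) (T z) - ?X (T y) \<in> I (Suc q) q (n + t)"
    using T y by metis
  moreover have "connecting q (n + t - deg (q + 2)) (T y) (T w)"
    using Suc.IH[OF Suc.prems(1) _ y(4)] Suc.prems unfolding n by simp
  moreover have "T y \<in> E q (n + t - deg (q + 2))" using T(2)[OF y(2)] unfolding n .
  moreover have "T z \<in> E (Suc q) (n + t)" using T(2)[OF y(1)] .
  ultimately show ?case by auto
qed (auto simp: chain_op_def)

text \<open>Let X be X_{q+2}. If z = D y + X a + u, then D z = X (D a) + D u. Comparing this with D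
  z = X w' modulo X_1, ..., X_{q+1} and cancelling the regular X shows that w' is the boundary D a
  modulo these variables.\<close>

lemma connecting_well_defined:
  "q < m \<Longrightarrow> connecting q n z w \<Longrightarrow> z \<in> B q n \<Longrightarrow> w \<in> B 0 (n - total_deg q)"
proof (induction q arbitrary: n z)
  case (Suc q)
  let ?X = "X (q + 2)" and ?n' = "n - deg (q + 2)"
  have q: "Suc q < m" "q + 2 = Suc (Suc q)" "Suc (Suc q) \<in> {1..m}" using Suc.prems by auto
  obtain w' where w': "z \<in> E (Suc q) n" "w' \<in> E q ?n'"
      "D (Suc q) z - ?X w' \<in> I (Suc q) q n" "connecting q ?n' w' w"
    using Suc.prems by auto
  obtain y v where y: "z = D (Suc (Suc q)) y + v" "y \<in> E (Suc (Suc q)) n"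
      "v \<in> I (Suc (Suc q)) (Suc q) n"
    using Suc.prems by (auto simp: B_def)
  obtain a u where a: "v = ?X a + u" "a \<in> E (Suc q) ?n'" "u \<in> I (Suc q) (Suc q) n"
    using y(3) unfolding I_Suc[OF q(1)] q(2) by blast
  have E: "D (Suc (Suc q)) y \<in> E (Suc q) n" "?X a \<in> E (Suc q) n" "u \<in> E (Suc q) n"
    using D_in_E[OF y(2)] X_in_E'[OF _ a(2)] I_in_E[OF _ a(3)] q by auto
  have "D (Suc q) z = ?X (D (Suc q) a) + D (Suc q) u"
    using E y a q D_D[OF y(2)] by (simp add: D_add E_add D_X)
  then have "?X (w' - D (Suc q) a) = D (Suc q) u - (D (Suc q) z - ?X w')"
    by (simp add: X_diff)
  moreover have "\<dots> \<in> I (Suc q) q n"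
    using I_diff[OF _ I_D[OF _ a(3)] w'(3)] q by simp
  ultimately have "?X (w' - D (Suc q) a) \<in> I (Suc q) q (?n' + deg (q + 2))" by simp
  then have "w' - D (Suc q) a \<in> I (Suc q) q ?n'"
    using I_regular[of "Suc q" "w' - D (Suc q) a" q ?n'] E_diff[OF w'(2) D_in_E[OF a(2)]] q by simp
  then have "w' \<in> B q ?n'"
    unfolding B_def using a(2)
    by (intro CollectI exI[of _ a] exI[of _ "w' - D (Suc q) a"]) simp
  then show ?case
    using Suc.IH[OF _ w'(4)] q by (simp add: total_deg_Suc algebra_simps)
qed (simp add: total_deg_0)

text \<open>The kernel of one connecting map is the image of H_{q+1} modulo X_1, ..., X_{q+1}, which
  is zero by \<open>homology_vanishes\<close>.\<close>

lemma connecting_injective: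
  "q < m \<Longrightarrow> connecting q n z w \<Longrightarrow> w \<in> B 0 (n - total_deg q) \<Longrightarrow> z \<in> B q n"
proof (induction q arbitrary: n z)
  case (Suc q)
  let ?X = "X (q + 2)" and ?n' = "n - deg (q + 2)"
  have q: "Suc q < m" "q + 2 = Suc (Suc q)" "Suc (Suc q) \<in> {1..m}" using Suc.prems by auto
  obtain w' where w': "z \<in> E (Suc q) n" "w' \<in> E q ?n'"
      "D (Suc q) z - ?X w' \<in> I (Suc q) q n" "connecting q ?n' w' w"
    using Suc.prems by auto
  have "w' \<in> B q ?n'"
    using Suc.IH[OF _ w'(4)] Suc.prems by (simp add: total_deg_Suc algebra_simps)
  then obtain y u where y: "w' = D (Suc q) y + u" "y \<in> E (Suc q) ?n'" "u \<in> I (Suc q) q ?n'"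
    by (auto simp: B_def)
  have XyE: "?X y \<in> E (Suc q) n" using X_in_E' y q by simp
  have "D (Suc q) (z - ?X y) = (D (Suc q) z - ?X w') + ?X u"
    using w' y XyE q by (simp add: D_diff D_X X_add)
  moreover have "?X u \<in> I (Suc q) q n"
    using chain_op_I[OF chain_op_X[OF q(3)] _ y(3)] q by simp
  ultimately have "D (Suc q) (z - ?X y) \<in> I (Suc q) q n"
    using I_add[OF _ w'(3)] q by simp
  then obtain y' where y': "y' \<in> E (Suc (Suc q)) n"
      "z - ?X y - D (Suc (Suc q)) y' \<in> I (Suc q) (Suc q) n"
    using homology_vanishes[of "Suc q" q "z - ?X y" n] q E_diff[OF w'(1) XyE] by auto
  have "?X y + (z - ?X y - D (Suc (Suc q)) y') \<in> I (Suc (Suc q)) (Suc q) n"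
    unfolding I_Suc[OF q(1)] q(2) using y(2) y'(2) unfolding q(2) by blast
  moreover have "z = D (Suc (Suc q)) y' + (?X y + (z - ?X y - D (Suc (Suc q)) y'))" by simp
  ultimately show ?case unfolding B_def using y'(1) by blast
qed (simp add: total_deg_0)

text \<open>A connecting map lands in the kernel of its own variable, so the composite lands in the
  classes of \<open>E 0\<close> modulo \<open>B 0\<close> killed by X_2, ..., X_{q+1}.\<close>

lemma connecting_total:
  "q < m \<Longrightarrow> z \<in> Z q n \<Longrightarrow> \<exists>w. connecting q n z w \<and>
     (\<forall>j\<in>{2..q+1}. X j w \<in> B 0 (n - total_deg q + deg j))"
proof (induction q arbitrary: n z)
  case (Suc q)
  let ?X = "X (q + 2)" and ?n' = "n - deg (q + 2)"
  have q: "Suc q < m" "q + 2 = Suc (Suc q)" "Suc (Suc q) \<in> {1..m}" using Suc.prems by auto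
  have z: "z \<in> E (Suc q) n" "D (Suc q) z \<in> I (Suc (Suc q)) q n"
    using Suc.prems by (auto simp: Z_def)
  then obtain w u where w: "D (Suc q) z = ?X w + u" "w \<in> E q ?n'" "u \<in> I (Suc q) q n"
    unfolding I_Suc[OF q(1)] q(2) by blast
  have uE: "u \<in> E q n" using I_in_E[OF _ w(3)] q by simp
  have "w \<in> Z q ?n'"
  proof (cases q)
    case (Suc i)
    have "D q (D (Suc q) z) = 0" using D_D z(1) Suc by simp
    then have "?X (D q w) = - D q u"
      using w(1) D_add[of "?X w" i n u] D_X[of "q + 2" w i ?n'] w(2) uE Suc q
        X_in_E'[of "q + 2" w q n]
      by (simp add: eq_neg_iff_add_eq_0)
    moreover have "D q u \<in> I (Suc q) i n" using I_D w(3) Suc q by simp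
    ultimately have "?X (D q w) \<in> I (Suc q) i (?n' + deg (q + 2))" using I_uminus q by simp
    then have "D q w \<in> I (Suc q) i ?n'"
      using I_regular[of "Suc q" "D q w" i ?n'] D_in_E[of w i ?n'] w(2) Suc q by simp
    then show ?thesis using Suc w by (simp add: Z_def)
  qed (use w in \<open>simp add: Z_def\<close>)
  then obtain w' where w': "connecting q ?n' w w'"
      "\<And>j. j \<in> {2..q+1} \<Longrightarrow> X j w' \<in> B 0 (?n' - total_deg q + deg j)"
    using Suc.IH[of w ?n'] q by auto
  have conn: "connecting (Suc q) n z w'"
    using z w w'(1) by (auto intro!: exI[of _ w])
  \<comment> \<open>X w is a boundary modulo X_1, ..., X_{q+1}. The lower connecting maps commute
    with X, so X w' is zero modulo \<open>B 0\<close>.\<close>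
  have "?X w = D (Suc q) z + (- u)" using w by simp
  then have "?X w \<in> B q n"
    unfolding B_def using z(1) I_uminus[OF _ w(3)] Suc.prems(1) by (metis (mono_tags, lifting) less_imp_le mem_Collect_eq)
  moreover have "connecting q (?n' + deg (q + 2)) (?X w) (?X w')"
    using connecting_chain_op[OF chain_op_X[OF q(3)] _ w'(1)] q by simp
  ultimately have "?X w' \<in> B 0 (n - total_deg q)"
    using connecting_well_defined[of q n "?X w" "?X w'"] q by simp
  then have "X j w' \<in> B 0 (n - total_deg (Suc q) + deg j)" if "j \<in> {2..Suc q + 1}" for j
    using that w'(2)[of j] by (cases "j = q + 2") (auto simp: total_deg_Suc algebra_simps)
  with conn show ?case by blast
qed (auto simp: Z_def)

text \<open>Every class killed by the variables is reached: if X w is zero modulo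
  \<open>B 0\<close>, injectivity of the lower maps gives X w' = D z + u, and this z is a preimage
  of w'.\<close>

lemma connecting_surjective:
  "q < m \<Longrightarrow> w \<in> E 0 (n - total_deg q) \<Longrightarrow>
    (\<And>j. j \<in> {2..q+1} \<Longrightarrow> X j w \<in> B 0 (n - total_deg q + deg j)) \<Longrightarrow> \<exists>z. connecting q n z w"
proof (induction q arbitrary: n)
  case (Suc q)
  let ?X = "X (q + 2)" and ?n' = "n - deg (q + 2)"
  have q: "Suc q < m" "q + 2 = Suc (Suc q)" "Suc (Suc q) \<in> {1..m}" using Suc.prems by auto
  have deg: "n - total_deg (Suc q) = ?n' - total_deg q" by (simp add: total_deg_Suc)
  obtain w' where w': "connecting q ?n' w' w"
    using Suc.IH[of ?n'] Suc.prems(2,3) q unfolding deg by auto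
  have "connecting q (?n' + deg (q + 2)) (?X w') (?X w)"
    using connecting_chain_op[OF chain_op_X[OF q(3)] _ w'] q by simp
  moreover have "?X w \<in> B 0 (n - total_deg q)"
    using Suc.prems(3)[of "q + 2"] by (simp add: total_deg_Suc)
  ultimately have "?X w' \<in> B q n"
    using connecting_injective[of q n "?X w'" "?X w"] q by simp
  then obtain z u where z: "?X w' = D (Suc q) z + u" "z \<in> E (Suc q) n" "u \<in> I (Suc q) q n"
    by (auto simp: B_def)
  have "D (Suc q) z - ?X w' = - u" using z by simp
  then have "D (Suc q) z - ?X w' \<in> I (Suc q) q n" using I_uminus[OF _ z(3)] q by simp
  moreover have "w' \<in> E q ?n'" using connecting_in_Z[OF _ w'] q by (simp add: Z_def)
  ultimately have "connecting (Suc q) n z w" using z w' by auto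
  then show ?case by blast
qed (auto simp: total_deg_0)

end

section \<open>Graded free modules over a polynomial ring\<close>

lemma lookup_single_mult_plus:
  fixes p :: "'a::cancel_comm_monoid_add \<Rightarrow>\<^sub>0 'b::semiring_0"
  shows "Poly_Mapping.lookup (Poly_Mapping.single a c * p) (a + b) = c * Poly_Mapping.lookup p b"
proof -
  have "Poly_Mapping.lookup (Poly_Mapping.single a c * p) (a + b) =
      (\<Sum>l. c * (\<Sum>q. Poly_Mapping.lookup p q when a + b = l + q) when l = a)"
    unfolding lookup_mult by (rule Sum_any.cong) (simp add: lookup_single when_def)
  also have "\<dots> = c * (\<Sum>q. Poly_Mapping.lookup p q when b = q)"
    by simp
  finally show ?thesis by (simp only: Sum_any_when_equal')
qed

lemma keys_single_mult:
  fixes p :: "'a::cancel_comm_monoid_add \<Rightarrow>\<^sub>0 'b::semiring_no_zero_divisors"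
  assumes "c \<noteq> 0"
  shows "Poly_Mapping.keys (Poly_Mapping.single a c * p) = (+) a ` Poly_Mapping.keys p"
proof
  show "Poly_Mapping.keys (Poly_Mapping.single a c * p) \<subseteq> (+) a ` Poly_Mapping.keys p"
    using keys_mult[of "Poly_Mapping.single a c" p] assms by auto
  show "(+) a ` Poly_Mapping.keys p \<subseteq> Poly_Mapping.keys (Poly_Mapping.single a c * p)"
    using assms by (auto simp: in_keys_iff lookup_single_mult_plus)
qed

lemma keys_plus_nat:
  fixes a b :: "'a \<Rightarrow>\<^sub>0 nat"
  shows "Poly_Mapping.keys (a + b) = Poly_Mapping.keys a \<union> Poly_Mapping.keys b"
  by (auto simp: in_keys_iff lookup_add)

lemma monom_deg_eq_sum:
  assumes "finite A" "Poly_Mapping.keys a \<subseteq> A"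
  shows "monom_deg d a = (\<Sum>i\<in>A. Poly_Mapping.lookup a i * d i)"
  unfolding monom_deg_def
  by (rule sum.mono_neutral_left) (use assms in \<open>auto simp: in_keys_iff\<close>)

lemma monom_deg_plus: "monom_deg d (a + b) = monom_deg d a + monom_deg d b"
proof -
  let ?A = "Poly_Mapping.keys a \<union> Poly_Mapping.keys b"
  have "monom_deg d c = (\<Sum>i\<in>?A. Poly_Mapping.lookup c i * d i)"
    if "c \<in> {a, b, a + b}" for c
    using that by (intro monom_deg_eq_sum) (auto simp: keys_plus_nat)
  then show ?thesis by (simp add: lookup_add algebra_simps sum.distrib)
qed

lemma monom_deg_single: "monom_deg d (Poly_Mapping.single j k) = k * d j"
  by (simp add: monom_deg_def)

lemma monom_deg_zero: "monom_deg d 0 = 0"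
  by (simp add: monom_deg_def)

text \<open>For a polynomial this is the value at the point where all variables equal 1.\<close>

definition coeff_sum :: "('a \<Rightarrow>\<^sub>0 'b::comm_ring_1) \<Rightarrow> 'b" where
  "coeff_sum p = (\<Sum>a\<in>Poly_Mapping.keys p. Poly_Mapping.lookup p a)"

lemma coeff_sum_superset:
  assumes "finite A" "Poly_Mapping.keys p \<subseteq> A"
  shows "coeff_sum p = (\<Sum>a\<in>A. Poly_Mapping.lookup p a)"
  unfolding coeff_sum_def
  by (rule sum.mono_neutral_left) (use assms in \<open>auto simp: in_keys_iff\<close>)

lemma coeff_sum_diff: "coeff_sum (p - q) = coeff_sum p - coeff_sum q"
proof -
  let ?A = "Poly_Mapping.keys p \<union> Poly_Mapping.keys q"
  have "coeff_sum r = (\<Sum>a\<in>?A. Poly_Mapping.lookup r a)" if "r \<in> {p, q, p - q}" for r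
    using that keys_diff[of p q] by (intro coeff_sum_superset) auto
  then show ?thesis by (simp add: lookup_minus sum_subtractf)
qed

lemma coeff_sum_single_mult:
  fixes p :: "'a::cancel_comm_monoid_add \<Rightarrow>\<^sub>0 'b::field"
  shows "coeff_sum (Poly_Mapping.single a c * p) = c * coeff_sum p"
proof (cases "c = 0")
  case False
  have "coeff_sum (Poly_Mapping.single a c * p) =
      (\<Sum>b\<in>Poly_Mapping.keys p. Poly_Mapping.lookup (Poly_Mapping.single a c * p) (a + b))"
    unfolding coeff_sum_def keys_single_mult[OF False] by (subst sum.reindex) auto
  then show ?thesis by (simp add: lookup_single_mult_plus coeff_sum_def sum_distrib_left)
qed (simp add: coeff_sum_def)

lemma coeff_sum_single: "coeff_sum (Poly_Mapping.single a c) = c"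
  by (simp add: coeff_sum_def)

text \<open>The free modules, their degree parts and the submodules (X_1, ..., X_r) F_i are all
  spanned by monomials times basis vectors, so each is encoded by a predicate on pairs of basis
  index j and exponent a.\<close>

definition supported :: "(nat \<Rightarrow> (nat \<Rightarrow>\<^sub>0 nat) \<Rightarrow> bool) \<Rightarrow> (nat \<Rightarrow> 'k::field mpoly) \<Rightarrow> bool" where
  "supported P v \<longleftrightarrow> (\<forall>j. \<forall>a\<in>Poly_Mapping.keys (v j). P j a)"

text \<open>The projection onto such a span. It yields homogeneous components and the decomposition
  in \<open>I_Suc_E\<close>.\<close>

definition restrict_terms ::
    "(nat \<Rightarrow> (nat \<Rightarrow>\<^sub>0 nat) \<Rightarrow> bool) \<Rightarrow> (nat \<Rightarrow> 'k::field mpoly) \<Rightarrow> nat \<Rightarrow> 'k mpoly" where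
  "restrict_terms P v =
     (\<lambda>j. Abs_poly_mapping (\<lambda>a. if P j a then Poly_Mapping.lookup (v j) a else 0))"

definition smul :: "'k::field mpoly \<Rightarrow> (nat \<Rightarrow> 'k mpoly) \<Rightarrow> nat \<Rightarrow> 'k mpoly" where
  "smul p v = (\<lambda>j. p * v j)"

lemma lookup_restrict_terms:
  "Poly_Mapping.lookup (restrict_terms P v j) a =
     (if P j a then Poly_Mapping.lookup (v j) a else 0)"
proof -
  have "finite {a. (if P j a then Poly_Mapping.lookup (v j) a else 0) \<noteq> 0}"
    by (rule finite_subset[of _ "Poly_Mapping.keys (v j)"]) (auto simp: in_keys_iff)
  then show ?thesis by (simp add: restrict_terms_def)
qed

lemma keys_restrict_terms:
  "Poly_Mapping.keys (restrict_terms P v j) = {a \<in> Poly_Mapping.keys (v j). P j a}"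
  by (auto simp: in_keys_iff lookup_restrict_terms split: if_splits)

lemma supported_restrict_terms:
  "supported P (restrict_terms P v)"
  "supported Q v \<Longrightarrow> supported Q (restrict_terms P v)"
  by (auto simp: supported_def keys_restrict_terms)

lemma restrict_terms_add:
  "restrict_terms P (u + v) = restrict_terms P u + restrict_terms P v"
  by (auto intro!: ext poly_mapping_eqI simp: lookup_restrict_terms lookup_add)

lemma restrict_terms_complement:
  "restrict_terms P v + restrict_terms (\<lambda>j a. \<not> P j a) v = v"
  by (auto intro!: ext poly_mapping_eqI simp: lookup_restrict_terms lookup_add)

lemma restrict_terms_id: "supported P v \<Longrightarrow> restrict_terms P v = v"
  by (intro ext poly_mapping_eqI, unfold lookup_restrict_terms supported_def)
    (metis not_in_keys_iff_lookup_eq_zero)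

lemma restrict_terms_disjoint:
  "supported Q v \<Longrightarrow> (\<And>j a. Q j a \<Longrightarrow> \<not> P j a) \<Longrightarrow> restrict_terms P v = 0"
proof (intro ext poly_mapping_eqI)
  fix j a assume "supported Q v" and *: "\<And>j a. Q j a \<Longrightarrow> \<not> P j a"
  then have "\<not> P j a" if "a \<in> Poly_Mapping.keys (v j)" using that by (auto simp: supported_def)
  then show "Poly_Mapping.lookup (restrict_terms P v j) a = Poly_Mapping.lookup (0 j) a"
    by (auto simp: lookup_restrict_terms in_keys_iff)
qed

lemma supported_mono: "supported P v \<Longrightarrow> (\<And>j a. P j a \<Longrightarrow> Q j a) \<Longrightarrow> supported Q v"
  by (auto simp: supported_def)

lemma supported_conj: "supported P v \<Longrightarrow> supported Q v \<Longrightarrow> supported (\<lambda>j a. P j a \<and> Q j a) v"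
  by (auto simp: supported_def)

lemma supported_zero: "supported P 0"
  by (simp add: supported_def)

lemma supported_False: "supported (\<lambda>_ _. False) v \<Longrightarrow> v = 0"
  by (auto simp: supported_def)

lemma supported_add: "supported P u \<Longrightarrow> supported P v \<Longrightarrow> supported P (u + v)"
  by (auto simp: supported_def dest!: subsetD[OF keys_add])

lemma supported_diff: "supported P u \<Longrightarrow> supported P v \<Longrightarrow> supported P (u - v)"
  by (auto simp: supported_def dest!: subsetD[OF keys_diff])

lemma supported_smul_single:
  assumes "c \<noteq> 0"
  shows "supported P (smul (Poly_Mapping.single b c) v) \<longleftrightarrow> supported (\<lambda>j a. P j (b + a)) v"
  unfolding supported_def smul_def keys_single_mult[OF assms] by blast

lemma smul_diff: "smul p (u - v) = smul p u - smul p v"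
  by (rule ext) (simp add: smul_def right_diff_distrib)

lemma smul_smul_commute: "smul p (smul q v) = smul q (smul p v)"
  by (rule ext) (simp add: smul_def mult.left_commute)

lemma free_vectors_poly_ring:
  "free_vectors (poly_ring m) b =
     {v. supported (\<lambda>j a. j \<in> {1..b} \<and> Poly_Mapping.keys a \<subseteq> {1..m}) v}"
  (is "?L = ?R")
proof (intro equalityI subsetI)
  fix v :: "nat \<Rightarrow> 'a mpoly" assume v: "v \<in> ?L"
  have "j \<in> {1..b} \<and> Poly_Mapping.keys a \<subseteq> {1..m}" if "a \<in> Poly_Mapping.keys (v j)" for j a
    using v that by (cases "j \<in> {1..b}") (auto simp: free_vectors_def poly_ring_def)
  then show "v \<in> ?R" by (simp add: supported_def)
next
  fix v :: "nat \<Rightarrow> 'a mpoly" assume v: "v \<in> ?R"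
  then have "Poly_Mapping.keys (v j) = {}" if "j \<notin> {1..b}" for j
    using that unfolding supported_def by blast
  then have "v j = 0" if "j \<notin> {1..b}" for j
    using that by simp
  moreover have "\<forall>a\<in>Poly_Mapping.keys (v j). Poly_Mapping.keys a \<subseteq> {1..m}" for j
    using v unfolding supported_def by simp
  ultimately show "v \<in> ?L" unfolding free_vectors_def poly_ring_def by blast
qed

locale graded_resolution =
  fixes m :: nat and d :: "nat \<Rightarrow> nat" and \<beta> :: "nat \<Rightarrow> nat" and C :: "nat \<Rightarrow> nat \<Rightarrow> nat"
    and D :: "nat \<Rightarrow> (nat \<Rightarrow> 'k::field mpoly) \<Rightarrow> (nat \<Rightarrow> 'k mpoly)"
  assumes resolution: "minimal_graded_resolution m d \<beta> C D"
    and m_pos: "m \<ge> 1"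
begin

abbreviation F :: "nat \<Rightarrow> (nat \<Rightarrow> 'k mpoly) set" where
  "F i \<equiv> free_vectors (poly_ring m) (\<beta> i)"

text \<open>Degrees are integers so that n - deg j needs no truncation; the parts of negative degree
  are zero.\<close>

definition E :: "nat \<Rightarrow> int \<Rightarrow> (nat \<Rightarrow> 'k mpoly) set" where
  "E i n = {v \<in> F i. supported (\<lambda>j a. int (monom_deg d a) + int (C j i) = n) v}"

text \<open>The monomial form of (X_1, ..., X_r) F_i: regularity of X_{r+1} becomes a statement
  about supports.\<close>

definition I :: "nat \<Rightarrow> nat \<Rightarrow> int \<Rightarrow> (nat \<Rightarrow> 'k mpoly) set" where
  "I r i n = {v \<in> E i n. supported (\<lambda>j a. Poly_Mapping.keys a \<inter> {1..r} \<noteq> {}) v}"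

abbreviation X :: "nat \<Rightarrow> (nat \<Rightarrow> 'k mpoly) \<Rightarrow> nat \<Rightarrow> 'k mpoly" where
  "X j \<equiv> smul (Poly_Mapping.single (Poly_Mapping.single j 1) 1)"

abbreviation deg :: "nat \<Rightarrow> int" where "deg j \<equiv> int (d j)"

lemmas resolution_conjuncts =
  resolution[unfolded minimal_graded_resolution_def Let_def One_nat_def]

lemma rank_0: "\<beta> 0 = 1"
  using resolution_conjuncts[THEN conjunct1] by simp

lemma C_0: "C (Suc 0) 0 = 0"
  by (rule resolution_conjuncts[THEN conjunct2, THEN conjunct1])

lemma D_add_F:
  "u \<in> F (Suc i) \<Longrightarrow> v \<in> F (Suc i) \<Longrightarrow> D (Suc i) (u + v) = D (Suc i) u + D (Suc i) v"
  unfolding plus_fun_def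
  by (rule resolution_conjuncts[THEN conjunct2, THEN conjunct2, THEN conjunct1, rule_format])

lemma D_smul:
  "p \<in> poly_ring m \<Longrightarrow> v \<in> F (Suc i) \<Longrightarrow> D (Suc i) (smul p v) = smul p (D (Suc i) v)"
  unfolding smul_def
  by (rule resolution_conjuncts[THEN conjunct2, THEN conjunct2, THEN conjunct2, THEN conjunct1,
        rule_format])

lemma D_graded:
  "D (Suc i) ` graded_part m d (\<beta> (Suc i)) (\<lambda>j. C j (Suc i)) k \<subseteq> graded_part m d (\<beta> i) (\<lambda>j. C j i) k"
  by (rule resolution_conjuncts[THEN conjunct2, THEN conjunct2, THEN conjunct2, THEN conjunct2,
        THEN conjunct1, THEN spec, THEN spec])

lemma D_image_0: "D 1 ` F 1 = {v \<in> F 0. semigroup_ring_map d (v 1) = 0}"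
  unfolding One_nat_def
  by (rule resolution_conjuncts[THEN conjunct2, THEN conjunct2, THEN conjunct2, THEN conjunct2,
        THEN conjunct2, THEN conjunct1])

lemma D_image: "D (Suc (Suc i)) ` F (Suc (Suc i)) = {v \<in> F (Suc i). D (Suc i) v = 0}"
  unfolding zero_fun_def
  by (rule resolution_conjuncts[THEN conjunct2, THEN conjunct2, THEN conjunct2, THEN conjunct2,
        THEN conjunct2, THEN conjunct2, THEN conjunct1, THEN spec])

lemma D_minimal: "D (Suc i) ` F (Suc i) \<subseteq> free_vectors (irrelevant_ideal m) (\<beta> i)"
  by (rule resolution_conjuncts[THEN conjunct2, THEN conjunct2, THEN conjunct2, THEN conjunct2,
        THEN conjunct2, THEN conjunct2, THEN conjunct2, THEN spec])

section \<open>Linearity of the differential and its homogeneous components\<close>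

lemma F_zero: "0 \<in> F i"
  by (simp add: free_vectors_poly_ring supported_zero)

lemma F_diff: "u \<in> F i \<Longrightarrow> v \<in> F i \<Longrightarrow> u - v \<in> F i"
  by (simp add: free_vectors_poly_ring supported_diff)

lemma D_zero_F: "D (Suc i) 0 = 0"
  using D_add_F[OF F_zero F_zero, of i] by simp

lemma D_diff_F: "u \<in> F (Suc i) \<Longrightarrow> v \<in> F (Suc i) \<Longrightarrow> D (Suc i) (u - v) = D (Suc i) u - D (Suc i) v"
  using D_add_F[OF F_diff, of u i v v] by (simp add: algebra_simps)

lemma E_F: "v \<in> E i n \<Longrightarrow> v \<in> F i"
  by (simp add: E_def)

lemma E_iff: "v \<in> E i n \<longleftrightarrow> supported (\<lambda>j a. (j \<in> {1..\<beta> i} \<and> Poly_Mapping.keys a \<subseteq> {1..m}) \<and>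
    int (monom_deg d a) + int (C j i) = n) v"
  unfolding E_def free_vectors_poly_ring supported_def by simp metis

lemma graded_part_eq_E: "graded_part m d (\<beta> i) (\<lambda>j. C j i) k = E i (int k)"
proof -
  have "(\<forall>j\<in>{1..\<beta> i}. \<forall>a\<in>Poly_Mapping.keys (v j). monom_deg d a + C j i = k) \<longleftrightarrow>
      supported (\<lambda>j a. int (monom_deg d a) + int (C j i) = int k) v" if "v \<in> F i" for v :: "nat \<Rightarrow> 'k mpoly"
    using that unfolding free_vectors_poly_ring supported_def
    by (metis (mono_tags, lifting) mem_Collect_eq of_nat_add of_nat_eq_iff)
  then show ?thesis unfolding graded_part_def E_def by blast
qed

lemma E_negative:
  assumes "n < 0"
  shows "E i n = {0}"
proof -
  have "v = 0" if "v \<in> E i n" for v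
  proof -
    have "supported (\<lambda>j a. int (monom_deg d a) + int (C j i) = n) v" using that by (simp add: E_def)
    then have "supported (\<lambda>_ _. False) v" by (rule supported_mono) (use assms in linarith)
    then show ?thesis by (rule supported_False)
  qed
  moreover have "0 \<in> E i n" by (simp add: E_def F_zero supported_zero)
  ultimately show ?thesis by blast
qed

lemma D_E: "u \<in> E (Suc i) n \<Longrightarrow> D (Suc i) u \<in> E i n"
proof (cases "n < 0")
  case True
  then show "u \<in> E (Suc i) n \<Longrightarrow> D (Suc i) u \<in> E i n" by (simp add: E_negative D_zero_F)
next
  case False
  then have "n = int (nat n)" by simp
  then show "u \<in> E (Suc i) n \<Longrightarrow> D (Suc i) u \<in> E i n"
    using D_graded[of i "nat n"] by (simp only: graded_part_eq_E image_subset_iff)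
qed

abbreviation component :: "nat \<Rightarrow> int \<Rightarrow> (nat \<Rightarrow> 'k mpoly) \<Rightarrow> nat \<Rightarrow> 'k mpoly" where
  "component i n \<equiv> restrict_terms (\<lambda>j a. int (monom_deg d a) + int (C j i) = n)"

lemma component_in_E: "v \<in> F i \<Longrightarrow> component i n v \<in> E i n"
  by (simp add: E_def free_vectors_poly_ring supported_restrict_terms)

lemma component_E: "v \<in> E i k \<Longrightarrow> component i n v = (if n = k then v else 0)"
proof (cases "n = k")
  case True
  then show "v \<in> E i k \<Longrightarrow> component i n v = (if n = k then v else 0)"
    by (simp add: E_def restrict_terms_id)
next
  case False
  then show "v \<in> E i k \<Longrightarrow> component i n v = (if n = k then v else 0)"
    using restrict_terms_disjoint[of "\<lambda>j a. int (monom_deg d a) + int (C j i) = k" v]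
    by (simp add: E_def)
qed

text \<open>The differential is homogeneous on each degree part and additive on F, so the degrees in
  the finite set N are split off one at a time.\<close>

lemma D_component_aux:
  assumes "finite N" "v \<in> F (Suc i)"
    "supported (\<lambda>j a. int (monom_deg d a) + int (C j (Suc i)) \<in> N) v"
  shows "D (Suc i) (component (Suc i) n v) = component i n (D (Suc i) v)"
  using assms
proof (induction N arbitrary: v)
  case empty
  then have "supported (\<lambda>_ _. False) v" by simp
  then have "v = 0" by (rule supported_False)
  then show ?case
    by (simp only: D_zero_F restrict_terms_id[OF supported_zero])
next
  case (insert k N)
  define v1 where "v1 = component (Suc i) k v"
  define v2 where
    "v2 = restrict_terms (\<lambda>j a. \<not> (int (monom_deg d a) + int (C j (Suc i)) = k)) v"
  have v: "v = v1 + v2" unfolding v1_def v2_def by (rule restrict_terms_complement[symmetric])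
  have v1: "v1 \<in> E (Suc i) k" unfolding v1_def using insert component_in_E by blast
  have v2: "v2 \<in> F (Suc i)"
    using insert by (simp add: v2_def free_vectors_poly_ring supported_restrict_terms)
  have "supported (\<lambda>j a. int (monom_deg d a) + int (C j (Suc i)) \<in> N) v2"
    unfolding v2_def
    by (rule supported_mono[OF supported_conj[OF supported_restrict_terms(2)[OF insert.prems(2)]
            supported_restrict_terms(1)]]) auto
  from insert.IH[OF v2 this]
  have IH: "D (Suc i) (component (Suc i) n v2) = component i n (D (Suc i) v2)" .
  have "D (Suc i) (component (Suc i) n v1) = component i n (D (Suc i) v1)"
    using component_E[OF v1] component_E[OF D_E[OF v1]] by (simp add: D_zero_F)
  moreover have "component (Suc i) n v1 \<in> F (Suc i)" "component (Suc i) n v2 \<in> F (Suc i)"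
    using component_in_E E_F v1 v2 by blast+
  ultimately show ?case
    using D_add_F[OF E_F[OF v1] v2] IH by (simp only: v restrict_terms_add D_add_F)
qed

lemma D_component:
  assumes "v \<in> F (Suc i)"
  shows "D (Suc i) (component (Suc i) n v) = component i n (D (Suc i) v)"
proof (rule D_component_aux[OF _ assms])
  let ?N = "\<Union>j\<in>{1..\<beta> (Suc i)}. (\<lambda>a. int (monom_deg d a) + int (C j (Suc i))) `
    Poly_Mapping.keys (v j)"
  show "finite ?N" by simp
  show "supported (\<lambda>j a. int (monom_deg d a) + int (C j (Suc i)) \<in> ?N) v"
    using assms unfolding free_vectors_poly_ring supported_def by blast
qed

text \<open>The resolution provides a preimage in the whole module; its degree n component is again
  a preimage, because D commutes with components.\<close>

lemma D_exact_E:
  assumes "u \<in> E (Suc i) n" "D (Suc i) u = 0"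
  shows "\<exists>v\<in>E (Suc (Suc i)) n. D (Suc (Suc i)) v = u"
proof -
  have "u \<in> D (Suc (Suc i)) ` F (Suc (Suc i))"
    unfolding D_image using E_F[OF assms(1)] assms(2) by (intro CollectI conjI)
  then obtain v where v: "v \<in> F (Suc (Suc i))" "u = D (Suc (Suc i)) v" by (elim imageE)
  then have "D (Suc (Suc i)) (component (Suc (Suc i)) n v) = u"
    using D_component[OF v(1)] component_E[OF assms(1), of n] by (simp only: refl if_True)
  then show ?thesis
    by (rule bexI[where x = "component (Suc (Suc i)) n v", OF _ component_in_E[OF v(1)]])
qed

definition augmentation :: "(nat \<Rightarrow> 'k mpoly) \<Rightarrow> 'k" where
  "augmentation v = coeff_sum (v 1)"

lemma augmentation_diff: "augmentation (u - v) = augmentation u - augmentation v"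
  by (simp add: augmentation_def coeff_sum_diff)

lemma augmentation_smul: "augmentation (smul (Poly_Mapping.single a c) v) = c * augmentation v"
  by (simp add: augmentation_def smul_def coeff_sum_single_mult)

text \<open>All monomials of degree n map to z^n, so only the coefficient sum survives:
  \<open>augmentation\<close> is the coordinate on the degree n part of k[S].\<close>

lemma semigroup_ring_map_E_0:
  assumes "v \<in> E 0 n"
  shows "semigroup_ring_map d (v 1) = monom (augmentation v) (nat n)"
proof -
  have "monom_deg d a = nat n" if "a \<in> Poly_Mapping.keys (v 1)" for a
  proof -
    have "int (monom_deg d a) + int (C 1 0) = n"
      using assms that unfolding E_def supported_def by blast
    then show ?thesis by (simp add: C_0)
  qed
  then show ?thesis
    by (simp add: semigroup_ring_map_def augmentation_def coeff_sum_def monom_sum)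
qed

lemma D_image_E_0: "D 1 ` E 1 n = {v \<in> E 0 n. augmentation v = 0}"
proof (intro equalityI subsetI)
  fix v assume "v \<in> D 1 ` E 1 n"
  then obtain u where u: "u \<in> E 1 n" "v = D 1 u" by (elim imageE)
  then have vE: "v \<in> E 0 n" using D_E[of u 0 n] by (simp only: One_nat_def)
  have "v \<in> D 1 ` F 1" unfolding u(2) by (rule imageI[OF E_F[OF u(1)]])
  then have "semigroup_ring_map d (v 1) = 0" unfolding D_image_0 by (elim CollectE conjE)
  then show "v \<in> {v \<in> E 0 n. augmentation v = 0}"
    using vE semigroup_ring_map_E_0[OF vE] by (simp only: monom_eq_0_iff mem_Collect_eq)
next
  fix v assume "v \<in> {v \<in> E 0 n. augmentation v = 0}"
  then have v: "v \<in> E 0 n" "augmentation v = 0" by simp_all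
  have "semigroup_ring_map d (v 1) = 0"
    using semigroup_ring_map_E_0[OF v(1)] by (simp only: v(2) monom_eq_0)
  then have "v \<in> D 1 ` F 1" unfolding D_image_0 using E_F[OF v(1)] by (intro CollectI conjI)
  then obtain u where u: "u \<in> F 1" "v = D 1 u" by (elim imageE)
  then have "v = D 1 (component 1 n u)"
    using D_component[of u 0 n] component_E[OF v(1), of n] by (simp only: One_nat_def refl if_True)
  then show "v \<in> D 1 ` E 1 n" 
    by (rule image_eqI[where x = "component 1 n u", OF _ component_in_E[OF u(1)]])
qed

section \<open>Multiplication by variables and the submodules (X_1, ..., X_r) F_i\<close>

lemma smul_single_in_E:
  assumes "v \<in> E i n" "Poly_Mapping.keys b \<subseteq> {1..m}"
  shows "smul (Poly_Mapping.single b c) v \<in> E i (n + int (monom_deg d b))"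
proof (cases "c = 0")
  case True
  then have "smul (Poly_Mapping.single b c) v = 0" by (simp add: smul_def zero_fun_def)
  then show ?thesis using F_zero supported_zero by (simp add: E_def)
next
  case False
  show ?thesis
    using assms(1) unfolding E_iff supported_smul_single[OF False]
    by (rule supported_mono) (use assms(2) in \<open>auto simp: keys_plus_nat monom_deg_plus\<close>)
qed

lemma X_E: "j \<in> {1..m} \<Longrightarrow> v \<in> E i n \<Longrightarrow> X j v \<in> E i (n + deg j)"
  using smul_single_in_E[of v i n "Poly_Mapping.single j 1" 1] by (simp add: monom_deg_single)

lemma single_in_poly_ring: "Poly_Mapping.keys b \<subseteq> {1..m} \<Longrightarrow> Poly_Mapping.single b c \<in> poly_ring m"
  by (simp add: poly_ring_def)

text \<open>Terms containing one of X_1, ..., X_r form u; all other terms must contain X_{r+1} and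
  can be divided by it.\<close>

lemma I_Suc_E:
  assumes "r < m"
  shows "I (Suc r) i n = {X (Suc r) w + u | w u. w \<in> E i (n - deg (Suc r)) \<and> u \<in> I r i n}"
proof (intro equalityI subsetI)
  fix v assume v: "v \<in> I (Suc r) i n"
  let ?x = "Poly_Mapping.single (Suc r) 1 :: nat \<Rightarrow>\<^sub>0 nat"
  let ?P = "\<lambda>(j::nat) (a :: nat \<Rightarrow>\<^sub>0 nat). Poly_Mapping.keys a \<inter> {1..r} \<noteq> {}"
  define u where "u = restrict_terms ?P v"
  define v' where "v' = restrict_terms (\<lambda>j a. \<not> ?P j a) v"
  have uv: "v = v' + u" unfolding u_def v'_def
    by (subst add.commute) (rule restrict_terms_complement[symmetric])
  have u: "u \<in> I r i n"
    using v by (simp add: u_def I_def E_def free_vectors_poly_ring supported_restrict_terms)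
  have v'E: "v' \<in> E i n"
    using v by (simp add: v'_def I_def E_def free_vectors_poly_ring supported_restrict_terms)
  have v'x: "Suc r \<in> Poly_Mapping.keys a" if "a \<in> Poly_Mapping.keys (v' j)" for a j
  proof -
    have "Poly_Mapping.keys a \<inter> {1..Suc r} \<noteq> {}" "Poly_Mapping.keys a \<inter> {1..r} = {}"
      using that v unfolding v'_def keys_restrict_terms I_def supported_def by auto
    then show ?thesis by (auto simp: atLeastAtMostSuc_conv)
  qed
  have inj: "inj ((+) ?x)" by simp
  \<comment> \<open>Division by X_{r+1}: the coefficient of w at b is that of v' at b + ?x. Nothing
    is lost, since every monomial of v' is divisible by X_{r+1}.\<close>
  define w where "w = (\<lambda>j. Poly_Mapping.map_key ((+) ?x) (v' j))"
  have lookup_w: "Poly_Mapping.lookup (w j) b = Poly_Mapping.lookup (v' j) (?x + b)" for j b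
    unfolding w_def by (simp only: map_key.rep_eq[OF inj] o_apply)
  have Xw: "X (Suc r) w = v'"
  proof (intro ext poly_mapping_eqI)
    fix j a
    show "Poly_Mapping.lookup (X (Suc r) w j) a = Poly_Mapping.lookup (v' j) a"
    proof (cases "Suc r \<in> Poly_Mapping.keys a")
      case True
      then have "a = ?x + (a - ?x)"
        by (intro poly_mapping_eqI) (auto simp: lookup_add lookup_minus lookup_single when_def in_keys_iff)
      then obtain b where "a = ?x + b" by blast
      then show ?thesis by (simp add: smul_def lookup_single_mult_plus lookup_w)
    next
      case False
      then have "a \<notin> (+) ?x ` Poly_Mapping.keys (w j)" by (auto simp: keys_plus_nat)
      then have "a \<notin> Poly_Mapping.keys (X (Suc r) w j)"
        by (simp add: smul_def keys_single_mult)
      moreover have "a \<notin> Poly_Mapping.keys (v' j)" using False v'x by blast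
      ultimately show ?thesis by (simp add: in_keys_iff)
    qed
  qed
  have "w \<in> E i (n - deg (Suc r))"
    using v'E unfolding Xw[symmetric] E_iff supported_smul_single[OF one_neq_zero]
    by (rule supported_mono) (auto simp: monom_deg_plus monom_deg_single keys_plus_nat)
  then show "v \<in> {X (Suc r) w + u | w u. w \<in> E i (n - deg (Suc r)) \<and> u \<in> I r i n}"
    using Xw uv u by blast
next
  fix v assume "v \<in> {X (Suc r) w + u | w u. w \<in> E i (n - deg (Suc r)) \<and> u \<in> I r i n}"
  then obtain w u where v: "v = X (Suc r) w + u" "w \<in> E i (n - deg (Suc r))" "u \<in> I r i n"
    by blast
  have "X (Suc r) w \<in> E i n" using X_E[of "Suc r" w i "n - deg (Suc r)"] v assms by simp
  moreover have "supported (\<lambda>j a. Poly_Mapping.keys a \<inter> {1..Suc r} \<noteq> {}) (X (Suc r) w)"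
    unfolding supported_smul_single[OF one_neq_zero] by (simp add: supported_def keys_plus_nat)
  moreover have "supported (\<lambda>j a. Poly_Mapping.keys a \<inter> {1..Suc r} \<noteq> {}) u"
    using v(3) unfolding I_def by (auto elim!: supported_mono)
  ultimately show "v \<in> I (Suc r) i n"
    using v by (simp add: I_def E_def free_vectors_poly_ring supported_add)
qed

text \<open>A factor X_{r+1} does not change which of X_1, ..., X_r occur in a monomial.\<close>

lemma I_regular_E:
  assumes "w \<in> E i n" "X (Suc r) w \<in> I r i (n + deg (Suc r))"
  shows "w \<in> I r i n"
proof -
  have "({Suc r} \<union> Poly_Mapping.keys a) \<inter> {1..r} = Poly_Mapping.keys a \<inter> {1..r}"
    for a :: "nat \<Rightarrow>\<^sub>0 nat" by auto
  then show ?thesis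
    using assms unfolding I_def mem_Collect_eq supported_smul_single[OF one_neq_zero]
    by (simp add: keys_plus_nat)
qed

sublocale regular_complex E D X deg I m
proof
  show "0 \<in> E i n" for i n by (simp add: E_def F_zero supported_zero)
  show "u - v \<in> E i n" if "u \<in> E i n" "v \<in> E i n" for u v i n
    using that by (simp add: E_def F_diff supported_diff)
  show "X j (u - v) = X j u - X j v" for j u v by (rule smul_diff)
  show "X j (X k u) = X k (X j u)" for j k u by (rule smul_smul_commute)
  show "X j u \<in> E i (n + deg j)" if "j \<in> {1..m}" "u \<in> E i n" for j u i n using that by (rule X_E)
  show "D (Suc i) u \<in> E i n" if "u \<in> E (Suc i) n" for u i n using that by (rule D_E)
  show "D (Suc i) (u - v) = D (Suc i) u - D (Suc i) v" if "u \<in> E (Suc i) n" "v \<in> E (Suc i) n"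
    for u v i n using that by (intro D_diff_F E_F)
  show "D (Suc i) (X j u) = X j (D (Suc i) u)" if "j \<in> {1..m}" "u \<in> E (Suc i) n" for j u i n
    using that by (intro D_smul E_F single_in_poly_ring) auto
  show "D (Suc i) (D (Suc (Suc i)) u) = 0" if "u \<in> E (Suc (Suc i)) n" for u i n
    using imageI[OF E_F[OF that], of "D (Suc (Suc i))"] unfolding D_image by (elim CollectE conjE)
  show "\<exists>v\<in>E (Suc (Suc i)) n. D (Suc (Suc i)) v = u"
    if "u \<in> E (Suc i) n" "D (Suc i) u = 0" for u i n using that by (rule D_exact_E)
  show "I 0 i n = {0}" for i n
    by (auto simp: I_def E_def F_zero supported_zero dest: supported_False)
  show "I (Suc r) i n = {X (Suc r) w + u | w u. w \<in> E i (n - deg (Suc r)) \<and> u \<in> I r i n}"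
    if "r < m" for r i n using that by (rule I_Suc_E)
  show "w \<in> I r i n" if "w \<in> E i n" "X (Suc r) w \<in> I r i (n + deg (Suc r))" for r w i n
    using that by (rule I_regular_E)
  \<comment> \<open>The image of D 1 consists of the vectors of augmentation 0, and multiplication
    by X_1 preserves the augmentation.\<close>
  show "w \<in> D 1 ` E 1 n" if "w \<in> E 0 n" "X 1 w \<in> D 1 ` E 1 (n + deg 1)" for w n
    using that unfolding D_image_E_0 by (simp add: augmentation_smul)
qed

end

section \<open>Syzygy degrees and pseudo-Frobenius numbers\<close>

lemma num_semigroupI: "s = int (\<Sum>i=1..m. x i * d i) \<Longrightarrow> s \<in> num_semigroup m d"
  unfolding num_semigroup_def by (intro CollectI exI[of _ x]) simp

lemma num_semigroup_0: "0 \<in> num_semigroup m d"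
  by (rule num_semigroupI[of _ "\<lambda>_. 0"]) simp

lemma num_semigroup_nonneg: "s \<in> num_semigroup m d \<Longrightarrow> 0 \<le> s"
  by (auto simp: num_semigroup_def simp del: of_nat_sum)

lemma num_semigroup_add:
  assumes "s \<in> num_semigroup m d" "t \<in> num_semigroup m d"
  shows "s + t \<in> num_semigroup m d"
proof -
  obtain x y where "s = int (\<Sum>i=1..m. x i * d i)" "t = int (\<Sum>i=1..m. y i * d i)"
    using assms by (auto simp: num_semigroup_def)
  then have "s + t = int (\<Sum>i=1..m. (x i + y i) * d i)"
    by (simp add: algebra_simps sum.distrib)
  then show ?thesis by (rule num_semigroupI)
qed

lemma generator_in_num_semigroup:
  assumes "j \<in> {1..m}"
  shows "int (d j) \<in> num_semigroup m d"
proof -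
  have "(\<Sum>i=1..m. (if i = j then 1 else 0) * d i) = (\<Sum>i=1..m. if i = j then d i else 0)"
    by (rule sum.cong) auto
  also have "\<dots> = d j" using assms by simp
  finally show ?thesis by (intro num_semigroupI[of _ "\<lambda>i. if i = j then 1 else 0"]) simp
qed

lemma num_semigroup_remove_generator:
  assumes "s \<in> num_semigroup m d" "s \<noteq> 0"
  shows "\<exists>j\<in>{1..m}. s - int (d j) \<in> num_semigroup m d"
proof -
  obtain x where x: "s = int (\<Sum>i=1..m. x i * d i)" using assms by (auto simp: num_semigroup_def)
  then obtain j where j: "j \<in> {1..m}" "x j * d j \<noteq> 0"
    using assms(2) by (metis (no_types, lifting) of_nat_0 sum.neutral)
  then obtain k where k: "x j = Suc k" by (cases "x j") auto
  have "(\<Sum>i=1..m. (x(j := k)) i * d i) = k * d j + (\<Sum>i\<in>{1..m}-{j}. x i * d i)"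
    using j(1) by (subst sum.remove[of _ j]) auto
  moreover have "(\<Sum>i=1..m. x i * d i) = Suc k * d j + (\<Sum>i\<in>{1..m}-{j}. x i * d i)"
    using j(1) k by (subst sum.remove[of _ j]) auto
  ultimately have "s - int (d j) = int (\<Sum>i=1..m. (x(j := k)) i * d i)"
    using x by simp
  then have "s - int (d j) \<in> num_semigroup m d" by (rule num_semigroupI)
  then show ?thesis using j(1) by blast
qed

text \<open>Every nonzero s in S is a generator plus an element of S, so testing the generators
  suffices; positivity makes each generator a nonzero element.\<close>

lemma pseudo_frobenius_iff:
  assumes "\<forall>i\<in>{1..m}. 0 < d i"
  shows "f \<in> pseudo_frobenius (num_semigroup m d) \<longleftrightarrow>
    f \<notin> num_semigroup m d \<and> (\<forall>j\<in>{1..m}. f + int (d j) \<in> num_semigroup m d)"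
proof
  assume "f \<in> pseudo_frobenius (num_semigroup m d)"
  then show "f \<notin> num_semigroup m d \<and> (\<forall>j\<in>{1..m}. f + int (d j) \<in> num_semigroup m d)"
    using generator_in_num_semigroup[of _ m d] assms
    by (auto simp: pseudo_frobenius_def)
next
  assume f: "f \<notin> num_semigroup m d \<and> (\<forall>j\<in>{1..m}. f + int (d j) \<in> num_semigroup m d)"
  have "f + s \<in> num_semigroup m d" if s: "s \<in> num_semigroup m d" "s \<noteq> 0" for s
  proof -
    obtain j where "j \<in> {1..m}" "s - int (d j) \<in> num_semigroup m d"
      using num_semigroup_remove_generator[OF s] by blast
    then show ?thesis
      using f num_semigroup_add[of "f + int (d j)" m d "s - int (d j)"] by simp
  qed
  then show "f \<in> pseudo_frobenius (num_semigroup m d)"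
    using f by (simp add: pseudo_frobenius_def)
qed

context graded_resolution
begin

section \<open>The two ends of the chain of connecting maps\<close>

abbreviation S :: "int set" where "S \<equiv> num_semigroup m d"

lemma augmentation_zero: "augmentation 0 = 0"
  by (simp add: augmentation_def coeff_sum_def)

lemma augmentation_add: "augmentation (u + v) = augmentation u + augmentation v"
  using augmentation_diff[of "u + v" v] by simp

text \<open>A representation of n by the generators is the exponent vector of a monomial of degree
  n. With \<open>augmentation_nonzero\<close>, the degree n part of k[S] is k for n in S and 0
  otherwise.\<close>

lemma exists_augmentation:
  assumes "n \<in> S"
  shows "\<exists>w\<in>E 0 n. augmentation w = c"
proof -
  obtain x where x: "n = int (\<Sum>i=1..m. x i * d i)" using assms by (auto simp: num_semigroup_def)
  define b where "b = (\<Sum>i=1..m. Poly_Mapping.single i (x i))"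
  have lookup_b: "Poly_Mapping.lookup b i = (if i \<in> {1..m} then x i else 0)" for i
    by (simp add: b_def lookup_sum lookup_single when_def)
  have b: "Poly_Mapping.keys b \<subseteq> {1..m}" by (auto simp: in_keys_iff lookup_b split: if_splits)
  have deg_b: "int (monom_deg d b) = n"
    using monom_deg_eq_sum[OF _ b, of d] by (simp add: x lookup_b)
  define w where "w = (\<lambda>j::nat. if j = 1 then Poly_Mapping.single b c else 0)"
  have "w \<in> E 0 n"
    unfolding E_iff supported_def using b deg_b
    by (auto simp: w_def rank_0 C_0 split: if_splits)
  moreover have "augmentation w = c" by (simp add: augmentation_def w_def coeff_sum_single)
  ultimately show ?thesis by blast
qed

lemma augmentation_nonzero:
  assumes "w \<in> E 0 n" "augmentation w \<noteq> 0"
  shows "n \<in> S"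
proof -
  have "Poly_Mapping.keys (w 1) \<noteq> {}"
    using assms(2) by (auto simp: augmentation_def coeff_sum_def simp del: keys_eq_empty)
  then obtain a where "a \<in> Poly_Mapping.keys (w 1)" by blast
  then have a: "Poly_Mapping.keys a \<subseteq> {1..m}" "int (monom_deg d a) + int (C 1 0) = n"
    using assms(1) unfolding E_iff supported_def by blast+
  then have "n = int (\<Sum>i=1..m. Poly_Mapping.lookup a i * d i)"
    using monom_deg_eq_sum[OF _ a(1), of d] by (simp add: C_0)
  then show ?thesis by (rule num_semigroupI)
qed

text \<open>\<open>E 0 n\<close> modulo \<open>B 0 n\<close> is the degree n part of k[S] / z^{d_1}
  k[S]. It is nonzero only if n is in S and n - d_1 is not, and then the augmentation detects
  it.\<close>

lemma B_0_iff:
  assumes "w \<in> E 0 n"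
  shows "w \<in> B 0 n \<longleftrightarrow> augmentation w = 0 \<or> n - deg 1 \<in> S"
proof
  assume "w \<in> B 0 n"
  then obtain y u where y: "w = D 1 y + u" "y \<in> E 1 n" "u \<in> I (Suc 0) 0 n"
    unfolding B_def One_nat_def by blast
  have "0 < m" using m_pos by simp
  from y(3) obtain w' where w': "u = X 1 w'" "w' \<in> E 0 (n - deg 1)"
    unfolding I_Suc[OF \<open>0 < m\<close>] I_0 One_nat_def by auto
  have "D 1 y \<in> D 1 ` E 1 n" using y(2) by (rule imageI)
  then have "augmentation (D 1 y) = 0" unfolding D_image_E_0 by simp
  then have "augmentation w = augmentation w'"
    unfolding y(1) w'(1) augmentation_add augmentation_smul by simp
  then show "augmentation w = 0 \<or> n - deg 1 \<in> S"
    using augmentation_nonzero[OF w'(2)] by auto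
next
  assume "augmentation w = 0 \<or> n - deg 1 \<in> S"
  then have "\<exists>w'\<in>E 0 (n - deg 1). augmentation w' = augmentation w"
  proof
    assume "augmentation w = 0"
    then show ?thesis using E_zero[of 0 "n - deg 1"] augmentation_zero by force
  qed (rule exists_augmentation)
  then obtain w' where w': "w' \<in> E 0 (n - deg 1)" "augmentation w' = augmentation w" by blast
  have Xw': "X 1 w' \<in> I (Suc 0) 0 n"
    using X_in_I[of 0 w' 0 n] w'(1) m_pos by simp
  have "X 1 w' \<in> E 0 n" using X_in_E'[of 1 w' 0 n] w'(1) m_pos by simp
  then have "w - X 1 w' \<in> {v \<in> E 0 n. augmentation v = 0}"
    using E_diff[OF assms] w'(2) by (simp add: augmentation_diff augmentation_smul)
  then obtain y where y: "w - X 1 w' = D 1 y" "y \<in> E 1 n"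
    unfolding D_image_E_0[symmetric] by (elim imageE)
  then have "w = D (Suc 0) y + X 1 w'" by (simp add: algebra_simps)
  then show "w \<in> B 0 n" unfolding B_def using y(2) Xw'
    by (intro CollectI exI[of _ y] exI[of _ "X 1 w'"] conjI) simp_all
qed

lemma I_m_iff:
  assumes "v \<in> E i n"
  shows "v \<in> I m i n \<longleftrightarrow> (\<forall>j. Poly_Mapping.lookup (v j) 0 = 0)"
proof -
  have "Poly_Mapping.keys a \<inter> {1..m} \<noteq> {} \<longleftrightarrow> a \<noteq> 0" if "a \<in> Poly_Mapping.keys (v j)" for a j
  proof -
    have "Poly_Mapping.keys a \<subseteq> {1..m}" using assms that unfolding E_iff supported_def by blast
    then show ?thesis by (simp add: Int_absorb2)
  qed
  then have "v \<in> I m i n \<longleftrightarrow> (\<forall>j. \<forall>a\<in>Poly_Mapping.keys (v j). a \<noteq> 0)"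
    using assms by (simp add: I_def supported_def)
  also have "\<dots> \<longleftrightarrow> (\<forall>j. 0 \<notin> Poly_Mapping.keys (v j))" by blast
  finally show ?thesis by (simp add: in_keys_iff)
qed

lemma D_in_I_m:
  assumes "v \<in> E (Suc i) n"
  shows "D (Suc i) v \<in> I m i n"
proof -
  have "D (Suc i) v \<in> free_vectors (irrelevant_ideal m) (\<beta> i)"
    using D_minimal[of i] E_F[OF assms] by (rule subsetD[OF _ imageI])
  then have "Poly_Mapping.lookup (D (Suc i) v j) 0 = 0" for j
    by (cases "j \<in> {1..\<beta> i}") (auto simp: free_vectors_def irrelevant_ideal_def)
  then show ?thesis using I_m_iff[OF D_in_E[OF assms]] by simp
qed

text \<open>All variables are divided out here, and by minimality the differentials vanish modulo
  them, so boundaries add nothing. With \<open>Z_top\<close>, the top homology is F_{m-1} / (X_1,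
  ..., X_m) F_{m-1}.\<close>

lemma B_top: "B (m - 1) n = I m (m - 1) n"
proof (intro equalityI subsetI)
  fix v assume "v \<in> B (m - 1) n"
  then obtain y u where "v = D (Suc (m - 1)) y + u" "y \<in> E (Suc (m - 1)) n"
    "u \<in> I (Suc (m - 1)) (m - 1) n" unfolding B_def by (elim CollectE exE conjE)
  moreover have "Suc (m - 1) = m" using m_pos by simp
  ultimately show "v \<in> I m (m - 1) n" using D_in_I_m[of y "m - 1" n] I_add[of m] by simp
next
  fix v assume "v \<in> I m (m - 1) n"
  then have "v = D (Suc (m - 1)) 0 + v \<and> 0 \<in> E (Suc (m - 1)) n \<and> v \<in> I (Suc (m - 1)) (m - 1) n"
    using m_pos E_zero by (simp only: D_zero) simp
  then show "v \<in> B (m - 1) n" unfolding B_def by (intro CollectI exI[of _ 0] exI[of _ v])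
qed

lemma Z_top:
  assumes "v \<in> E (m - 1) n"
  shows "v \<in> Z (m - 1) n"
proof -
  have m: "Suc (m - 1) = m" using m_pos by simp
  have "D (m - 1) v \<in> I m i n" if "m - 1 = Suc i" for i
    using assms D_in_I_m[of v i n] unfolding that by blast
  then show ?thesis using assms unfolding Z_def m by blast
qed

definition basis :: "nat \<Rightarrow> nat \<Rightarrow> 'k mpoly" where
  "basis k = (\<lambda>j. if j = k then 1 else 0)"

lemma basis_in_E:
  assumes "k \<in> {1..\<beta> i}"
  shows "basis k \<in> E i (int (C k i))"
  using assms unfolding E_iff supported_def by (auto simp: basis_def monom_deg_zero split: if_splits)

text \<open>This gives k-linearity of the connecting maps, needed to compare two basis vectors of
  equal degree.\<close>

lemma chain_op_scalar: "chain_op 0 (smul (Poly_Mapping.single 0 c))"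
  unfolding chain_op_def
proof (intro conjI allI impI)
  fix u v :: "nat \<Rightarrow> 'k mpoly" and i j n
  show "smul (Poly_Mapping.single 0 c) (u - v) =
      smul (Poly_Mapping.single 0 c) u - smul (Poly_Mapping.single 0 c) v" by (rule smul_diff)
  show "smul (Poly_Mapping.single 0 c) u \<in> E i (n + 0)" if "u \<in> E i n"
    using smul_single_in_E[OF that, of 0 c] by (simp add: monom_deg_zero)
  show "D (Suc i) (smul (Poly_Mapping.single 0 c) u) = smul (Poly_Mapping.single 0 c) (D (Suc i) u)"
    if "u \<in> E (Suc i) n"
    using that by (intro D_smul E_F single_in_poly_ring) simp_all
  show "smul (Poly_Mapping.single 0 c) (X j u) = X j (smul (Poly_Mapping.single 0 c) u)"
    by (rule smul_smul_commute)
qed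

text \<open>
  The top syzygies \<open>F\<^sub>m\<^sub>-\<^sub>1 / (X\<^sub>1, \<dots>, X\<^sub>m) F\<^sub>m\<^sub>-\<^sub>1\<close> are identified by the connecting maps with the
  socle of \<open>k[S] / z ^ d\<^sub>1 k[S]\<close>, which is spanned by the \<open>z ^ (f + d\<^sub>1)\<close> for the
  pseudo-Frobenius numbers \<open>f\<close>.
\<close>

theorem syzygy_degrees_bij:
  assumes pos: "\<forall>i\<in>{1..m}. 0 < d i"
  shows "bij_betw (\<lambda>k. int (C k (m - 1)) - (\<Sum>j=1..m. int (d j))) {1..\<beta> (m - 1)}
    (pseudo_frobenius S)"
proof -
  let ?q = "m - 1" and ?\<Sigma> = "\<Sum>j=1..m. int (d j)" and ?T = "total_deg (m - 1)"
  have q: "?q < m" "?q + 1 = m" using m_pos by auto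
  \<comment> \<open>The connecting maps account for d_2, ..., d_m; the remaining d_1 is the shift
    from f to the socle element of degree f + d_1.\<close>
  have \<Sigma>: "?\<Sigma> = ?T + deg 1"
    using m_pos unfolding total_deg_def q(2) by (subst sum.atLeast_Suc_atMost) (auto simp: numeral_2_eq_2)
  have image: "\<exists>w. connecting ?q (int (C k ?q)) (basis k) w \<and> augmentation w \<noteq> 0 \<and>
      int (C k ?q) - ?\<Sigma> \<in> pseudo_frobenius S" if k: "k \<in> {1..\<beta> ?q}" for k
  proof -
    let ?n = "int (C k ?q)"
    note bE = basis_in_E[OF k]
    obtain w where w: "connecting ?q ?n (basis k) w"
      "\<And>j. j \<in> {2..m} \<Longrightarrow> X j w \<in> B 0 (?n - ?T + deg j)"
      using connecting_total[OF q(1) Z_top[OF bE]] unfolding q(2) by blast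
    have wE: "w \<in> E 0 (?n - ?T)" by (rule connecting_in_E[OF w(1)])
    \<comment> \<open>A basis vector has a constant term, so it is nonzero in the top homology, and
      by injectivity so is its image w.\<close>
    have "Poly_Mapping.lookup (basis k k) 0 \<noteq> 0" by (simp add: basis_def)
    then have "basis k \<notin> B ?q ?n"
      unfolding B_top I_m_iff[OF bE] by blast
    then have "w \<notin> B 0 (?n - ?T)" using connecting_injective[OF q(1) w(1)] by blast
    then have aug: "augmentation w \<noteq> 0" and notin: "?n - ?T - deg 1 \<notin> S"
      unfolding B_0_iff[OF wE] by auto
    have "?n - ?\<Sigma> + deg j \<in> S" if j: "j \<in> {1..m}" for j
    proof (cases "j = 1")
      case True
      then show ?thesis using augmentation_nonzero[OF wE aug] unfolding \<Sigma> by simp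
    next
      case False
      \<comment> \<open>X_j kills the class of w but keeps its nonzero augmentation, so only the
        second alternative of \<open>B_0_iff\<close> remains.\<close>
      then have "X j w \<in> B 0 (?n - ?T + deg j)" using w(2)[of j] j by simp
      then have "?n - ?T + deg j - deg 1 \<in> S"
        unfolding B_0_iff[OF X_in_E[OF j wE]] augmentation_smul using aug by simp
      then show ?thesis unfolding \<Sigma> by (simp add: algebra_simps)
    qed
    moreover have "?n - ?\<Sigma> \<notin> S" using notin unfolding \<Sigma> by (simp add: algebra_simps)
    ultimately have "?n - ?\<Sigma> \<in> pseudo_frobenius S"
      unfolding pseudo_frobenius_iff[OF pos] by blast
    then show ?thesis using w(1) aug by blast
  qed
  have inj: "k = k'" if k: "k \<in> {1..\<beta> ?q}" "k' \<in> {1..\<beta> ?q}" "int (C k ?q) = int (C k' ?q)" for k k'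
  proof (rule ccontr)
    assume "k \<noteq> k'"
    let ?n = "int (C k ?q)"
    obtain w w' where w: "connecting ?q ?n (basis k) w" "connecting ?q ?n (basis k') w'"
      "augmentation w' \<noteq> 0"
      using image[OF k(1)] image[OF k(2)] unfolding k(3) by blast
    \<comment> \<open>The combination of the two basis vectors whose image has augmentation 0. It
      must lie in \<open>B\<close>, although its constant term at k is the nonzero
      \<open>augmentation w'\<close>.\<close>
    define z where "z = smul (Poly_Mapping.single 0 (augmentation w')) (basis k) -
      smul (Poly_Mapping.single 0 (augmentation w)) (basis k')"
    define u where "u = smul (Poly_Mapping.single 0 (augmentation w')) w -
      smul (Poly_Mapping.single 0 (augmentation w)) w'"
    have conn: "connecting ?q ?n z u"
      unfolding z_def u_def
      using connecting_diff[OF q(1) connecting_chain_op[OF chain_op_scalar q(1) w(1)]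
          connecting_chain_op[OF chain_op_scalar q(1) w(2)]] by simp
    have "augmentation u = 0"
      unfolding u_def augmentation_diff augmentation_smul by simp
    then have "u \<in> B 0 (?n - ?T)" using B_0_iff[OF connecting_in_E[OF conn]] by simp
    then have "z \<in> B ?q ?n" using connecting_injective[OF q(1) conn] by blast
    then have "Poly_Mapping.lookup (z k) 0 = 0"
      unfolding B_top using I_m_iff[OF I_in_E, of m z] by blast
    then show False using w(3) \<open>k \<noteq> k'\<close>
      by (simp add: z_def smul_def basis_def lookup_minus)
  qed
  have surj: "\<exists>k\<in>{1..\<beta> ?q}. int (C k ?q) - ?\<Sigma> = f" if f: "f \<in> pseudo_frobenius S" for f
  proof -
    let ?n = "f + ?\<Sigma>"
    have f': "f \<notin> S" "\<And>j. j \<in> {1..m} \<Longrightarrow> f + deg j \<in> S"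
      using f unfolding pseudo_frobenius_iff[OF pos] by blast+
    have nT: "?n - ?T = f + deg 1" unfolding \<Sigma> by simp
    have "f + deg 1 \<in> S" using f'(2) m_pos by simp
    then obtain w where w: "w \<in> E 0 (?n - ?T)" "augmentation w = 1"
      using exists_augmentation[of "?n - ?T" 1] unfolding nT by blast
    have "X j w \<in> B 0 (?n - ?T + deg j)" if "j \<in> {2..?q + 1}" for j
    proof -
      have j: "j \<in> {1..m}" using that q by auto
      show ?thesis 
        unfolding B_0_iff[OF X_in_E[OF j w(1)]] unfolding nT using f'(2)[OF j] by simp
    qed
    then obtain z where z: "connecting ?q ?n z w"
      using connecting_surjective[OF q(1) w(1)] by blast
    have zE: "z \<in> E ?q ?n" using connecting_in_Z[OF q(1) z] by (simp add: Z_def)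
    have "w \<notin> B 0 (?n - ?T)" 
      unfolding B_0_iff[OF w(1)] unfolding nT using w(2) f'(1) by simp
    then have "z \<notin> B ?q ?n" using connecting_well_defined[OF q(1) z] by blast
    \<comment> \<open>A nonzero class has a constant term in some component j, and homogeneity
      forces the degree of that basis vector to be f + ?\<Sigma>.\<close>
    then obtain j where "Poly_Mapping.lookup (z j) 0 \<noteq> 0"
      unfolding B_top I_m_iff[OF zE] by blast
    then have "0 \<in> Poly_Mapping.keys (z j)" by (simp add: in_keys_iff)
    moreover have "\<forall>a\<in>Poly_Mapping.keys (z j). (j \<in> {1..\<beta> ?q} \<and> Poly_Mapping.keys a \<subseteq> {1..m}) \<and>
        int (monom_deg d a) + int (C j ?q) = ?n"
      using zE unfolding E_iff supported_def by (rule spec)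
    ultimately have "j \<in> {1..\<beta> ?q}" "int (monom_deg d 0) + int (C j ?q) = ?n"
      by blast+
    then show ?thesis by (intro bexI[of _ j]) (simp_all add: monom_deg_zero)
  qed
  show ?thesis
    unfolding bij_betw_def
  proof (intro conjI inj_onI equalityI subsetI)
    fix k k' assume "k \<in> {1..\<beta> ?q}" "k' \<in> {1..\<beta> ?q}"
      "int (C k ?q) - ?\<Sigma> = int (C k' ?q) - ?\<Sigma>"
    then show "k = k'" using inj[of k k'] by linarith
  next
    fix f assume "f \<in> (\<lambda>k. int (C k ?q) - ?\<Sigma>) ` {1..\<beta> ?q}"
    then obtain k where "f = int (C k ?q) - ?\<Sigma>" "k \<in> {1..\<beta> ?q}" by (elim imageE)
    then show "f \<in> pseudo_frobenius S" using image[of k] by blast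
  next
    fix f assume "f \<in> pseudo_frobenius S"
    then obtain k where k: "k \<in> {1..\<beta> ?q}" "int (C k ?q) - ?\<Sigma> = f" by (elim bexE[OF surj])
    then show "f \<in> (\<lambda>k. int (C k ?q) - ?\<Sigma>) ` {1..\<beta> ?q}" by (intro rev_image_eqI[OF k(1)]) simp
  qed
qed

end

section \<open>Gaps and the Frobenius number\<close>

lemma Gcd_linear_combination:
  fixes d :: "nat \<Rightarrow> nat"
  assumes "finite A"
  shows "\<exists>y :: nat \<Rightarrow> int. int (Gcd (d ` A)) = (\<Sum>i\<in>A. y i * int (d i))"
  using assms
proof (induction A)
  case (insert a A)
  then obtain y where y: "int (Gcd (d ` A)) = (\<Sum>i\<in>A. y i * int (d i))" by blast
  obtain u v where uv: "u * int (d a) + v * int (Gcd (d ` A)) = gcd (int (d a)) (int (Gcd (d ` A)))"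
    using bezout_int by blast
  have "(\<Sum>i\<in>A. ((\<lambda>i. v * y i)(a := u)) i * int (d i)) = (\<Sum>i\<in>A. v * (y i * int (d i)))"
    by (rule sum.cong) (use insert.hyps in auto)
  then have "(\<Sum>i\<in>insert a A. ((\<lambda>i. v * y i)(a := u)) i * int (d i)) =
      u * int (d a) + v * int (Gcd (d ` A))"
    using insert.hyps by (simp add: y sum_distrib_left)
  also have "\<dots> = int (Gcd (d ` insert a A))"
    unfolding uv by (simp add: gcd_int_int_eq)
  finally show ?case by metis
qed simp

lemma num_semigroup_mult:
  assumes "s \<in> num_semigroup m d"
  shows "int k * s \<in> num_semigroup m d"
proof (induction k)
  case (Suc k)
  then show ?case using num_semigroup_add[OF assms Suc] by (simp add: algebra_simps)
qed (simp add: num_semigroup_0)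

text \<open>Separating the Bezout coefficients by sign gives consecutive elements a and b = a + 1 of
  S. If a > 0, every n >= a^2 equals (q - r) a + r b with r = n mod a < a <= q = n div a; if a = 0,
  then b = 1.\<close>

lemma num_semigroup_cofinite:
  assumes "Gcd (d ` {1..m}) = 1"
  shows "\<exists>N\<ge>0. \<forall>n\<ge>N. n \<in> num_semigroup m d"
proof -
  obtain y :: "nat \<Rightarrow> int" where y: "int (Gcd (d ` {1..m})) = (\<Sum>i=1..m. y i * int (d i))"
    using Gcd_linear_combination[of "{1..m}" d] by blast
  define a where "a = int (\<Sum>i=1..m. nat (- y i) * d i)"
  define b where "b = int (\<Sum>i=1..m. nat (y i) * d i)"
  have "b - a = (\<Sum>i=1..m. int (nat (y i)) * int (d i) - int (nat (- y i)) * int (d i))"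
    by (simp add: a_def b_def sum_subtractf)
  also have "\<dots> = (\<Sum>i=1..m. (int (nat (y i)) - int (nat (- y i))) * int (d i))"
    by (simp only: left_diff_distrib)
  also have "\<dots> = (\<Sum>i=1..m. y i * int (d i))"
    by (rule sum.cong) auto
  finally have b: "b = a + 1" using y assms by simp
  have aS: "a \<in> num_semigroup m d" unfolding a_def by (rule num_semigroupI) (rule refl)
  have bS: "b \<in> num_semigroup m d" unfolding b_def by (rule num_semigroupI) (rule refl)
  have a0: "0 \<le> a" using num_semigroup_nonneg[OF aS] .
  have "n \<in> num_semigroup m d" if n: "n \<ge> a * a" for n
  proof (cases "a = 0")
    case True
    then show ?thesis using num_semigroup_mult[OF bS, of "nat n"] n b by simp
  next
    case False
    then have "0 < a" using a0 by simp
    define q r where "q = n div a" and "r = n mod a"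
    have r: "0 \<le> r" "r < a" using \<open>0 < a\<close> by (simp_all add: r_def)
    have "a \<le> q" using n \<open>0 < a\<close> by (simp add: q_def pos_imp_zdiv_pos_iff zdiv_mono1[of "a * a" n a, simplified])
    have "n = q * a + r" by (simp add: q_def r_def)
    also have "\<dots> = (q - r) * a + r * b" by (simp add: b algebra_simps)
    also have "\<dots> = int (nat (q - r)) * a + int (nat r) * b" using r \<open>a \<le> q\<close> by simp
    finally show ?thesis
      using num_semigroup_add num_semigroup_mult[OF aS] num_semigroup_mult[OF bS] by metis
  qed
  then show ?thesis by (intro exI[of _ "a * a"]) simp
qed

lemma frobenius_spec:
  assumes "\<forall>s\<in>S. 0 \<le> s" "\<exists>N\<ge>0. \<forall>n\<ge>N. n \<in> S"
  shows "frobenius S \<notin> S" "\<And>n. n > frobenius S \<Longrightarrow> n \<in> S" "frobenius S \<ge> -1"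
proof -
  obtain N where N: "N \<ge> 0" "\<And>n. n \<ge> N \<Longrightarrow> n \<in> S" using assms(2) by blast
  let ?G = "{n. n \<notin> S \<and> -1 \<le> n \<and> n < N}"
  have fin: "finite ?G" by (rule finite_subset[of _ "{-1..<N}"]) auto
  \<comment> \<open>The number -1 keeps the set nonempty even if S contains all nonnegative
    integers; then the Frobenius number is -1.\<close>
  have neg: "-1 \<in> ?G" using assms(1) N(1) by force
  have max: "Max ?G \<in> ?G" using fin neg by (intro Max_in) auto
  have le: "n \<le> Max ?G" if "n \<notin> S" for n
  proof (cases "n < -1")
    case True
    then show ?thesis using max by auto
  next
    case False
    then have "n \<in> ?G" using that N(2)[of n] by force
    then show ?thesis using fin by simp
  qed
  have F: "frobenius S = Max ?G"
    unfolding frobenius_def using max le by (intro Greatest_equality) auto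
  show "frobenius S \<notin> S" "frobenius S \<ge> -1" using max unfolding F by auto
  show "n \<in> S" if "n > frobenius S" for n using that le[of n] unfolding F by force
qed

section \<open>Hilbert series and its value at \<open>z\<^sup>-\<^sup>1\<close>\<close>

lemma hilbert_series_eqI:
  assumes "b \<noteq> 0" "fps_of_poly b * hilbert_fps S = fps_of_poly a"
  shows "hilbert_series S = Fraction_Field.Fract a b"
  unfolding hilbert_series_def
proof (rule the_equality)
  show "\<exists>a' b'. b' \<noteq> 0 \<and> Fraction_Field.Fract a b = Fraction_Field.Fract a' b' \<and>
      fps_of_poly b' * hilbert_fps S = fps_of_poly a'"
    using assms by blast
next
  fix h assume "\<exists>a b. b \<noteq> 0 \<and> h = Fraction_Field.Fract a b \<and>
      fps_of_poly b * hilbert_fps S = fps_of_poly a"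
  then obtain a' b' where *: "b' \<noteq> 0" "h = Fraction_Field.Fract a' b'"
    "fps_of_poly b' * hilbert_fps S = fps_of_poly a'" by blast
  have "fps_of_poly (a' * b) = fps_of_poly (a * b')"
    unfolding fps_of_poly_mult *(3)[symmetric] assms(2)[symmetric] by (simp add: mult_ac)
  then have "a' * b = a * b'" by (simp only: fps_of_poly_eq_iff)
  then show "h = Fraction_Field.Fract a b" using * assms(1) by (simp add: eq_fract)
qed

lemma fps_one_minus_X_mult_ones: "(1 - fps_X) * Abs_fps (\<lambda>_. 1 :: 'a::comm_ring_1) = 1"
  by (rule fps_ext) (simp add: left_diff_distrib)

text \<open>The series is 1 / (1 - z) minus the polynomial of the gaps, over the common denominator
  1 - z.\<close>

lemma hilbert_series_gaps:
  assumes "finite G" "\<And>n. n \<in> G \<longleftrightarrow> int n \<notin> S"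
  shows "hilbert_series S =
    Fraction_Field.Fract (1 - [:1, -1:] * (\<Sum>g\<in>G. monom 1 g)) [:1, -1:]"
proof (rule hilbert_series_eqI)
  have "hilbert_fps S = Abs_fps (\<lambda>_. 1) - fps_of_poly (\<Sum>g\<in>G. monom 1 g)"
    by (rule fps_ext) (use assms in \<open>simp add: hilbert_fps_def coeff_sum\<close>)
  moreover have "fps_of_poly [:1, -1 :: rat:] = 1 - fps_X"
    by (rule fps_ext) (simp add: coeff_pCons fps_X_def split: nat.split)
  ultimately show "fps_of_poly [:1, -1:] * hilbert_fps S =
      fps_of_poly (1 - [:1, -1:] * (\<Sum>g\<in>G. monom 1 g))"
    by (simp only: fps_of_poly_diff fps_of_poly_mult fps_of_poly_1 right_diff_distrib
        fps_one_minus_X_mult_ones)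
qed simp

section \<open>Substitution into polynomials as a ring homomorphism, and into fractions\<close>

definition eval_ratfun :: "rat poly \<Rightarrow> ratfun \<Rightarrow> ratfun" where
  "eval_ratfun p y = poly (map_poly (\<lambda>c. to_fract [:c:]) p) y"

lemma eval_ratfun_pCons: "eval_ratfun (pCons c p) y = to_fract [:c:] + y * eval_ratfun p y"
  by (simp add: eval_ratfun_def map_poly_pCons)

lemma eval_ratfun_0: "eval_ratfun 0 y = 0"
  by (simp add: eval_ratfun_def)

lemma eval_ratfun_add: "eval_ratfun (p + q) y = eval_ratfun p y + eval_ratfun q y"
proof (induction p q rule: poly_induct2)
  case (pCons a p b q)
  have "to_fract [:a + b:] = to_fract [:a:] + to_fract [:b:]"
    by (simp flip: to_fract_add)
  with pCons show ?case by (simp add: eval_ratfun_pCons algebra_simps)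
qed (simp add: eval_ratfun_0)

lemma eval_ratfun_smult: "eval_ratfun (smult c p) y = to_fract [:c:] * eval_ratfun p y"
proof (induction p)
  case (pCons a p)
  have "to_fract [:c * a:] = to_fract [:c:] * to_fract [:a:]"
    by (simp flip: to_fract_mult)
  with pCons show ?case by (simp add: eval_ratfun_pCons algebra_simps)
qed (simp add: eval_ratfun_0)

lemma eval_ratfun_mult: "eval_ratfun (p * q) y = eval_ratfun p y * eval_ratfun q y"
proof (induction p)
  case (pCons a p)
  then show ?case
    by (simp add: mult_pCons_left eval_ratfun_add eval_ratfun_smult eval_ratfun_pCons algebra_simps)
qed (simp add: eval_ratfun_0)

lemma to_fract_const_1: "to_fract [:1 :: 'a::idom:] = 1"
  by (simp flip: one_pCons)

lemma eval_ratfun_1: "eval_ratfun 1 y = 1"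
  unfolding one_pCons eval_ratfun_pCons by (simp add: eval_ratfun_0 to_fract_const_1)

lemma eval_ratfun_diff: "eval_ratfun (p - q) y = eval_ratfun p y - eval_ratfun q y"
  using eval_ratfun_add[of "p - q" q y] by simp

lemma eval_ratfun_monom: "eval_ratfun (monom 1 n) y = y ^ n"
  by (simp add: eval_ratfun_def map_poly_monom poly_monom to_fract_const_1)

lemma eval_ratfun_sum: "eval_ratfun (\<Sum>i\<in>A. p i) y = (\<Sum>i\<in>A. eval_ratfun (p i) y)"
  by (induction A rule: infinite_finite_induct) (simp_all add: eval_ratfun_0 eval_ratfun_add)

text \<open>The denominator in lowest terms divides b, so it does not vanish at y either, and the
  identity p b = a q survives evaluation.\<close>

lemma ratfun_subst_Fract:
  assumes "eval_ratfun b y \<noteq> 0"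
  shows "ratfun_subst (Fraction_Field.Fract a b) y = eval_ratfun a y / eval_ratfun b y"
proof -
  define p q where "p = fst (quot_of_fract (Fraction_Field.Fract a b))"
    and "q = snd (quot_of_fract (Fraction_Field.Fract a b))"
  have b: "b \<noteq> 0" using assms by (auto simp: eval_ratfun_0)
  have q: "q \<noteq> 0" "coprime p q" unfolding p_def q_def by (simp_all add: coprime_quot_of_fract)
  have "Fraction_Field.Fract p q = Fraction_Field.Fract a b" unfolding p_def q_def by simp
  then have pq: "p * b = a * q" using b q by (simp add: eq_fract)
  then have "q dvd p * b" by simp
  then have "q dvd b" using q(2) by (simp add: coprime_commute coprime_dvd_mult_right_iff)
  then obtain r where "b = q * r" by blast
  then have "eval_ratfun q y \<noteq> 0" using assms by (auto simp: eval_ratfun_mult)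
  moreover have "eval_ratfun p y * eval_ratfun b y = eval_ratfun a y * eval_ratfun q y"
    using pq by (simp flip: eval_ratfun_mult)
  ultimately show ?thesis
    using assms by (simp add: ratfun_subst_def Let_def p_def q_def eval_ratfun_def frac_eq_eq)
qed

section \<open>Powers of z and geometric sums\<close>

lemma to_fract_monom: "to_fract (monom 1 n) = ratfun_z ^ n"
proof (induction n)
  case (Suc n)
  have "monom 1 (Suc n) = [:0, 1 :: rat:] * monom 1 n" by (simp add: monom_Suc)
  then show ?case by (simp only: to_fract_mult Suc power_Suc ratfun_z_def)
qed simp

lemma to_fract_sum: "to_fract (\<Sum>i\<in>A. p i) = (\<Sum>i\<in>A. to_fract (p i))"
  by (induction A rule: infinite_finite_induct) simp_all

lemma ratfun_z_nonzero: "ratfun_z \<noteq> 0"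
  by (simp add: ratfun_z_def)

lemma ratfun_z_ne_1: "ratfun_z \<noteq> 1"
proof
  assume "ratfun_z = 1"
  then have "to_fract [:0, 1 :: rat:] = to_fract 1" by (simp add: ratfun_z_def)
  then show False by (simp only: to_fract_eq_iff) (simp add: one_pCons)
qed

text \<open>The summands are what the part 1 / (1 - z) of the Hilbert series contributes to H(z) and
  to H(1/z) z^F. For F = -1 the sum is empty.\<close>

lemma sum_powi_interval:
  fixes z :: "'a::field"
  assumes "z \<noteq> 0" "z \<noteq> 1" "F \<ge> -1"
  shows "(\<Sum>n\<in>{0..F}. z powi n) = 1 / (1 - z) + z powi F / (1 - inverse z)"
proof -
  have "(\<Sum>n\<in>{0..F}. z powi n) = (\<Sum>i<nat (F + 1). z ^ i)"
    by (rule sum.reindex_bij_witness[of _ int nat]) (auto simp: power_int_def)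
  also have "\<dots> = (1 - z ^ nat (F + 1)) / (1 - z)"
    using assms(2) by (simp add: sum_gp_strict)
  also have "z ^ nat (F + 1) = z powi (F + 1)" using assms(3) by (simp add: power_int_def)
  also have "\<dots> = z powi F * z" using assms(1) by (simp add: power_int_add)
  also have "(1 - z powi F * z) / (1 - z) = 1 / (1 - z) - z powi F * z / (1 - z)"
    by (rule diff_divide_distrib)
  also have "1 / (1 - z) - z powi F * z / (1 - z) = 1 / (1 - z) + z powi F / (1 - inverse z)"
  proof -
    have "1 - inverse z = - ((1 - z) / z)" using assms(1) by (simp add: field_simps)
    then have "- (z powi F * z / (1 - z)) = z powi F / (1 - inverse z)" by simp
    then show ?thesis by (simp only: diff_conv_add_uminus)
  qed
  finally show ?thesis .
qed

text \<open>
  Writing \<open>H = 1 / (1 - z) - G\<close> with the polynomial \<open>G\<close> of the gaps, the coefficient of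
  \<open>z ^ n\<close> for \<open>0 \<le> n \<le> F\<close> is \<open>1 - [n \<notin> S] - [F - n \<notin> S] + [n \<in> \<Delta>\<^sub>H]\<close>, which vanishes as
  \<open>n\<close> and \<open>F - n\<close> are not both in \<open>S\<close>.
\<close>

lemma hilbert_series_duality:
  fixes S :: "int set"
  defines "F \<equiv> frobenius S"
  assumes S: "0 \<in> S" "\<And>s t. s \<in> S \<Longrightarrow> t \<in> S \<Longrightarrow> s + t \<in> S" "\<forall>s\<in>S. 0 \<le> s"
    "\<exists>N\<ge>0. \<forall>n\<ge>N. n \<in> S"
  shows "hilbert_series S + ratfun_subst (hilbert_series S) (inverse ratfun_z) * ratfun_z powi F
    + (\<Sum>h\<in>delta_H S. ratfun_z powi h) = 0"
proof -
  let ?z = ratfun_z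
  have F: "F \<notin> S" "\<And>n. n > F \<Longrightarrow> n \<in> S" "F \<ge> -1"
    unfolding F_def using frobenius_spec[OF S(3,4)] by blast+
  define G where "G = {n. int n \<notin> S}"
  have G_le: "int n \<le> F" if "n \<in> G" for n using that F(2)[of "int n"] by (force simp: G_def)
  have finG: "finite G"
    by (rule finite_subset[of _ "{..nat F}"]) (use G_le in force)+
  let ?b = "[:1, -1:] :: rat poly" and ?g = "\<Sum>g\<in>G. monom 1 g :: rat poly"
  have H: "hilbert_series S = Fraction_Field.Fract (1 - ?b * ?g) ?b"
    using hilbert_series_gaps[OF finG, of S] by (simp add: G_def)
  have b_monom: "?b = 1 - monom 1 1" by (simp add: monom_altdef one_pCons)
  have zb: "to_fract ?b = 1 - ?z"
    unfolding b_monom to_fract_diff to_fract_monom by simp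
  have "hilbert_series S = to_fract (1 - ?b * ?g) / to_fract ?b"
    unfolding H by (simp add: Fract_conv_to_fract)
  also have "\<dots> = 1 / (1 - ?z) - (\<Sum>g\<in>G. ?z ^ g)"
    using ratfun_z_ne_1 unfolding to_fract_diff to_fract_mult zb
    by (simp add: to_fract_sum to_fract_monom field_simps)
  finally have H1: "hilbert_series S = 1 / (1 - ?z) - (\<Sum>g\<in>G. ?z powi int g)" by simp
  have iz: "1 - inverse ?z \<noteq> 0" using ratfun_z_ne_1 by simp
  have evb: "eval_ratfun ?b (inverse ?z) = 1 - inverse ?z"
    unfolding b_monom eval_ratfun_diff eval_ratfun_monom by (simp add: eval_ratfun_1)
  have "ratfun_subst (hilbert_series S) (inverse ?z) =
      (1 - (1 - inverse ?z) * (\<Sum>g\<in>G. inverse ?z ^ g)) / (1 - inverse ?z)"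
    unfolding H ratfun_subst_Fract[OF iz[folded evb]] eval_ratfun_diff[of 1] eval_ratfun_mult evb
      eval_ratfun_1 eval_ratfun_sum eval_ratfun_monom by (rule refl)
  also have "\<dots> = 1 / (1 - inverse ?z) - (\<Sum>g\<in>G. inverse ?z ^ g)"
    using iz by (simp add: diff_divide_distrib)
  finally have "ratfun_subst (hilbert_series S) (inverse ?z) * ?z powi F =
      ?z powi F / (1 - inverse ?z) - (\<Sum>g\<in>G. inverse ?z ^ g * ?z powi F)"
    by (simp add: left_diff_distrib sum_distrib_right)
  also have "(\<Sum>g\<in>G. inverse ?z ^ g * ?z powi F) = (\<Sum>g\<in>G. ?z powi (F - int g))"
    by (rule sum.cong) (simp_all add: ratfun_z_nonzero power_int_diff power_inverse field_simps)
  finally have H2: "ratfun_subst (hilbert_series S) (inverse ?z) * ?z powi F =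
      ?z powi F / (1 - inverse ?z) - (\<Sum>g\<in>G. ?z powi (F - int g))" .
  have G1: "(\<Sum>g\<in>G. ?z powi int g) = (\<Sum>n\<in>{0..F}. if n \<notin> S then ?z powi n else 0)"
    unfolding sum.inter_filter[OF finite_atLeastAtMost_int, symmetric]
    by (rule sum.reindex_bij_witness[of _ nat int]) (use G_le in \<open>auto simp: G_def\<close>)
  have G2: "(\<Sum>g\<in>G. ?z powi (F - int g)) = (\<Sum>n\<in>{0..F}. if F - n \<notin> S then ?z powi n else 0)"
    unfolding sum.inter_filter[OF finite_atLeastAtMost_int, symmetric]
    by (rule sum.reindex_bij_witness[of _ "\<lambda>n. nat (F - n)" "\<lambda>g. F - int g"])
       (use G_le in \<open>auto simp: G_def\<close>)
  \<comment> \<open>For h < 0 the number F - h exceeds F and lies in S; for h > F the number h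
    itself does.\<close>
  have "delta_H S = {n \<in> {0..F}. n \<notin> S \<and> F - n \<notin> S}"
    using F(2) by (force simp: delta_H_def F_def[symmetric])
  then have D: "(\<Sum>h\<in>delta_H S. ?z powi h) =
      (\<Sum>n\<in>{0..F}. if n \<notin> S \<and> F - n \<notin> S then ?z powi n else 0)"
    by (simp only: sum.inter_filter[OF finite_atLeastAtMost_int])
  have both: "\<not> (n \<in> S \<and> F - n \<in> S)" for n using S(2)[of n "F - n"] F(1) by auto
  have "hilbert_series S + ratfun_subst (hilbert_series S) (inverse ?z) * ?z powi F
      + (\<Sum>h\<in>delta_H S. ?z powi h) =
      (\<Sum>n\<in>{0..F}. ?z powi n) - (\<Sum>n\<in>{0..F}. if n \<notin> S then ?z powi n else 0)
      - (\<Sum>n\<in>{0..F}. if F - n \<notin> S then ?z powi n else 0)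
      + (\<Sum>n\<in>{0..F}. if n \<notin> S \<and> F - n \<notin> S then ?z powi n else 0)"
    unfolding sum_powi_interval[OF ratfun_z_nonzero ratfun_z_ne_1 F(3)] H2 D unfolding H1 G1 G2 by simp
  also have "\<dots> = (\<Sum>n\<in>{0..F}. ?z powi n - (if n \<notin> S then ?z powi n else 0)
      - (if F - n \<notin> S then ?z powi n else 0)
      + (if n \<notin> S \<and> F - n \<notin> S then ?z powi n else 0))"
    by (simp only: sum.distrib sum_subtractf)
  also have "\<dots> = 0" by (rule sum.neutral) (use both in auto)
  finally show ?thesis .
qed

theorem theorem2:
  fixes m :: nat
    and d :: "nat \<Rightarrow> nat"
    and \<beta> :: "nat \<Rightarrow> nat"
    and C :: "nat \<Rightarrow> nat \<Rightarrow> nat"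
    and D :: "nat \<Rightarrow> (nat \<Rightarrow> 'k::field_char_0 mpoly) \<Rightarrow> (nat \<Rightarrow> 'k mpoly)"
    and Q' :: "rat poly"
    and S :: "int set" and F \<Sigma>\<^sub>m :: int
  defines "S \<equiv> num_semigroup m d"
    and "F \<equiv> frobenius S"
    and "\<Sigma>\<^sub>m \<equiv> \<Sum>k=1..m. int (d k)"
  assumes "m \<ge> 2"
    and "minimal_generators m d"
    and "almost_symmetric S"
    and "minimal_graded_resolution m d \<beta> C D"
    and "syzygy_degree_requirements m \<beta> C"
    and "syzygy_poly \<beta> C (m - 1) = Q' + monom 1 (nat (F + \<Sigma>\<^sub>m))"
    and "int (Polynomial.degree Q') < F + \<Sigma>\<^sub>m"
  shows "hilbert_series S
      + ratfun_subst (hilbert_series S) (inverse ratfun_z) * ratfun_z powi F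
      + to_fract Q' * ratfun_z powi (- \<Sigma>\<^sub>m) = 0"
proof -
  interpret graded_resolution m d \<beta> C D
    by standard (use assms in auto)
  have pos: "\<forall>i\<in>{1..m}. 0 < d i" and gcd: "Gcd (d ` {1..m}) = 1"
    using \<open>minimal_generators m d\<close> by (simp_all add: minimal_generators_def)
  have S: "0 \<in> S" "\<And>s t. s \<in> S \<Longrightarrow> t \<in> S \<Longrightarrow> s + t \<in> S" "\<forall>s\<in>S. 0 \<le> s"
    "\<exists>N\<ge>0. \<forall>n\<ge>N. n \<in> S"
    unfolding S_def using num_semigroup_0 num_semigroup_add num_semigroup_nonneg
      num_semigroup_cofinite[OF gcd] by blast+
  have F: "F \<notin> S" "\<And>n. n > F \<Longrightarrow> n \<in> S"
    unfolding F_def using frobenius_spec[OF S(3,4)] by blast+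
  have bij: "bij_betw (\<lambda>k. int (C k (m - 1)) - \<Sigma>\<^sub>m) {1..\<beta> (m - 1)} (pseudo_frobenius S)"
    unfolding S_def \<Sigma>\<^sub>m_def by (rule syzygy_degrees_bij[OF pos])
  have fin: "finite (pseudo_frobenius S)"
    using bij_betw_finite[OF bij] by simp
  have FPF: "F \<in> pseudo_frobenius S"
    using F S(3) by (force simp: pseudo_frobenius_def)
  \<comment> \<open>f + \<open>\<Sigma>\<^sub>m\<close> is a syzygy degree, so \<open>nat\<close>
    truncates nothing.\<close>
  have nonneg: "0 \<le> f + \<Sigma>\<^sub>m" if "f \<in> pseudo_frobenius S" for f
  proof -
    have "f \<in> (\<lambda>k. int (C k (m - 1)) - \<Sigma>\<^sub>m) ` {1..\<beta> (m - 1)}"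
      using that bij by (simp only: bij_betw_imp_surj_on)
    then show ?thesis by auto
  qed
  have "syzygy_poly \<beta> C (m - 1) =
      (\<Sum>k\<in>{1..\<beta> (m - 1)}. monom 1 (nat ((int (C k (m - 1)) - \<Sigma>\<^sub>m) + \<Sigma>\<^sub>m)))"
    by (simp add: syzygy_poly_def)
  also have "\<dots> = (\<Sum>f\<in>pseudo_frobenius S. monom 1 (nat (f + \<Sigma>\<^sub>m)))"
    by (rule sum.reindex_bij_betw[OF bij])
  also have "\<dots> = monom 1 (nat (F + \<Sigma>\<^sub>m)) + (\<Sum>f\<in>pseudo_frobenius S - {F}. monom 1 (nat (f + \<Sigma>\<^sub>m)))"
    by (rule sum.remove[OF fin FPF])
  also have "pseudo_frobenius S - {F} = delta_H S"
    using \<open>almost_symmetric S\<close> by (simp only: almost_symmetric_def F_def)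
  \<comment> \<open>The term of F is exactly the monomial separated from Q', and almost symmetry
    identifies the remaining exponents.\<close>
  finally have Q': "Q' = (\<Sum>h\<in>delta_H S. monom 1 (nat (h + \<Sigma>\<^sub>m)))"
    using \<open>syzygy_poly \<beta> C (m - 1) = Q' + monom 1 (nat (F + \<Sigma>\<^sub>m))\<close> by simp
  have "to_fract Q' * ratfun_z powi (- \<Sigma>\<^sub>m) =
      (\<Sum>h\<in>delta_H S. ratfun_z ^ nat (h + \<Sigma>\<^sub>m) * ratfun_z powi (- \<Sigma>\<^sub>m))"
    by (simp only: Q' to_fract_sum to_fract_monom sum_distrib_right)
  also have "\<dots> = (\<Sum>h\<in>delta_H S. ratfun_z powi h)"
  proof (rule sum.cong)
    fix h assume "h \<in> delta_H S"
    then have "h \<in> pseudo_frobenius S"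
      using \<open>almost_symmetric S\<close> unfolding almost_symmetric_def by blast
    then have "ratfun_z ^ nat (h + \<Sigma>\<^sub>m) = ratfun_z powi (h + \<Sigma>\<^sub>m)"
      using nonneg by (simp add: power_int_def)
    then show "ratfun_z ^ nat (h + \<Sigma>\<^sub>m) * ratfun_z powi (- \<Sigma>\<^sub>m) = ratfun_z powi h"
      using ratfun_z_nonzero by (simp flip: power_int_add)
  qed (rule refl)
  finally show ?thesis
    using hilbert_series_duality[OF S] by (simp only: F_def)
qed

end
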